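(* For every integer $k\ge4$, the exponent per edge of the complete graph tensor satisfies $$\tau(\mathrm{T}(K_k))\le\min_{q\ge2}\log_q\Bigl(\frac{q+2}{2}\Bigr)=\log_7(9/2),$$ where the minimum is over integers $q\ge2$; this value is approximately $0.772943$.
   Context: $K_k$ is the complete graph on $k$ vertices. $b_1,\dots,b_n$ is the standard basis of $\mathbb{C}^n$ and $[n]=\{1,\dots,n\}$. Products of $k$-tensors are regarded as $k$-tensors (legs grouped position by position). Let $\mathrm{T}=\sum_{i=1}^2b_i^{\otimes k}\in(\mathbb{C}^2)^{\otimes k}$. For $\phi\in U_1\otimes\cdots\otimes U_k$, $\psi\in V_1\otimes\cdots\otimes V_k$ (finite-dimensional complex spaces), $\phi\ge\psi$ if there are linear maps $A_i:U_i\to V_i$ with $\psi=(A_1\otimes\cdots\otimes A_k)\phi$. The exponent is $\omega(\psi)=\lim_{n\to\infty}\frac1n\min\{m\in\mathbb{N}\mid\mathrm{T}^{\otimes m}\ge\psi^{\otimes n}\}$ (the limit exists). For a finite simple graph $G=(V,E)$, $\mathrm{T}_n(G)=\sum_{i\in[n]^E}\bigotimes_{v\in V}\bigl(\bigotimes_{e\in E:\,v\in e}b_{i_e}\bigr)$, a $|V|$-tensor (one leg for each vertex); $\mathrm{T}(G)=\mathrm{T}_2(G)$; the exponent per edge is $\tau(\mathrm{T}(G))=\omega(\mathrm{T}(G))/|E|$. *)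

theory Defs
  imports Complex_Main "HOL-Library.FuncSet"
begin

text \<open>
  Finite-dimensional complex spaces are represented in coordinates. A tensor has a set of legs;
  the space at leg \<open>v\<close> is the complex vector space with basis indexed by the finite set
  \<open>basis t v\<close>, and the tensor is given by its coefficients \<open>coeff t x\<close> for
  \<open>x \<in> (\<Pi>\<^sub>E v\<in>legs t. basis t v)\<close>. Values of \<open>coeff t\<close> outside this set are irrelevant.
\<close>

record ('v, 'b) tensor =
  legs :: "'v set"
  basis :: "'v \<Rightarrow> 'b set"
  coeff :: "('v \<Rightarrow> 'b) \<Rightarrow> complex"

definition basis_vec :: "'b \<Rightarrow> 'b \<Rightarrow> complex" where
  "basis_vec i j = of_bool (i = j)"

text \<open>
  The linear map at leg \<open>v\<close> is given by its matrix \<open>A v\<close>, with row index in \<open>basis \<psi> v\<close> and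
  column index in \<open>basis \<phi> v\<close>.
\<close>

definition restricts_to :: "('v, 'b) tensor \<Rightarrow> ('v, 'c) tensor \<Rightarrow> bool" where
  "restricts_to \<phi> \<psi> \<longleftrightarrow>
     legs \<phi> = legs \<psi> \<and>
     (\<exists>A :: 'v \<Rightarrow> 'c \<Rightarrow> 'b \<Rightarrow> complex.
        \<forall>y \<in> (\<Pi>\<^sub>E v\<in>legs \<psi>. basis \<psi> v).
          coeff \<psi> y =
            (\<Sum>x \<in> (\<Pi>\<^sub>E v\<in>legs \<phi>. basis \<phi> v). (\<Prod>v\<in>legs \<phi>. A v (y v) (x v)) * coeff \<phi> x))"

text \<open>
  The \<open>n\<close>-th tensor power, legs grouped position by position: a basis index at leg \<open>v\<close> is a tuple
  of \<open>n\<close> basis indices of the original leg.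
\<close>

definition tensor_power :: "('v, 'b) tensor \<Rightarrow> nat \<Rightarrow> ('v, nat \<Rightarrow> 'b) tensor" where
  "tensor_power t n =
     \<lparr>legs = legs t,
      basis = (\<lambda>v. {..<n} \<rightarrow>\<^sub>E basis t v),
      coeff = (\<lambda>x. \<Prod>j<n. coeff t (\<lambda>v\<in>legs t. x v j))\<rparr>"

definition unit_tensor :: "'v set \<Rightarrow> ('v, nat) tensor" where
  "unit_tensor L =
     \<lparr>legs = L,
      basis = (\<lambda>v. {1..2}),
      coeff = (\<lambda>x. \<Sum>i\<in>{1..2}. \<Prod>v\<in>L. basis_vec i (x v))\<rparr>"

text \<open>
  For tensors with finitely many legs and finite bases the set under \<open>LEAST\<close> is nonempty and the
  limit exists (by subadditivity). The term at \<open>n = 0\<close> is immaterial.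
\<close>

definition exponent :: "('v, 'b) tensor \<Rightarrow> real" where
  "exponent \<psi> =
     lim (\<lambda>n. real (LEAST m. restricts_to (tensor_power (unit_tensor (legs \<psi>)) m) (tensor_power \<psi> n))
              / real n)"

text \<open>
  A simple graph is given by its vertex set \<open>V\<close> and its set \<open>E\<close> of two-element subsets of \<open>V\<close>.
  The space at vertex \<open>v\<close> is a tensor product over the edges incident to \<open>v\<close>, so its basis indices
  are functions on these edges.
\<close>

definition graph_tensor :: "nat \<Rightarrow> 'v set \<Rightarrow> 'v set set \<Rightarrow> ('v, 'v set \<Rightarrow> nat) tensor" where
  "graph_tensor n V E =
     \<lparr>legs = V,
      basis = (\<lambda>v. {e \<in> E. v \<in> e} \<rightarrow>\<^sub>E {1..n}),
      coeff = (\<lambda>x. \<Sum>i \<in> E \<rightarrow>\<^sub>E {1..n}. \<Prod>v\<in>V. \<Prod>e \<in> {e \<in> E. v \<in> e}. basis_vec (i e) (x v e))\<rparr>"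

definition exponent_per_edge :: "'v set \<Rightarrow> 'v set set \<Rightarrow> real" where
  "exponent_per_edge V E = exponent (graph_tensor 2 V E) / real (card E)"

definition complete_edges :: "'v set \<Rightarrow> 'v set set" where
  "complete_edges V = {e. e \<subseteq> V \<and> card e = 2}"

end

theory Submission
  imports
    Defs
    "HOL-Computational_Algebra.Polynomial"
    "HOL-Number_Theory.Cong"
    "HOL-Combinatorics.Multiset_Permutations"
begin

text \<open>
  The bound is an instance of the laser method. Let \<open>S\<close> be a set of four vertices and consider the tensor that
  sums, over all pairs \<open>e \<subseteq> S\<close> and all labels \<open>i \<in> {1..q}\<close>, the basis tensors with \<open>i\<close> at the two legs in
  \<open>e\<close> and \<open>0\<close> at the other two. It is a limit of tensors of rank \<open>q + 2\<close>, and averaging over roots of unity turns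
  this into an exact bound: its \<open>N\<close>-th power has rank at most \<open>(8 * N + 1) * (q + 2) ^ N\<close>
  (\<open>rank_le_cw_power\<close>).

  Expanded, this power is a sum of blocks, one for every word of \<open>N\<close> pairs. A leg \<open>v\<close> sees only the set of
  positions at which the pair contains \<open>v\<close>. If every pair occurs \<open>N / 6\<close> times in the word, its block is the
  tensor of the complete graph on \<open>S\<close> with \<open>N / 6\<close> labels from \<open>q\<close> values on every edge. Zeroing out basis
  vectors retains a family of such words; what remains is a direct sum if no further word can be pieced together
  from the position sets of the family, leg by leg. Linear hashing to a sphere yields families
  of \<open>2 powr (N - o(N))\<close> words with this property (\<open>large_free_family\<close>).

  A direct sum of \<open>L\<close> copies of a tensor whose rank is at most \<open>L * t\<close> bounds the rank of the \<open>s\<close>-th power of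
  that tensor by \<open>L * t ^ s\<close> (\<open>rank_le_edge_tensor_powers\<close>). Here \<open>t\<close> is about \<open>((q + 2) / 2) ^ N\<close>, which
  pays for \<open>N / 6\<close> labels on each of the six edges: every edge costs \<open>(q + 2) / 2\<close> per label with \<open>q\<close> values.
  The product over all four-subsets of \<open>V\<close> treats all pairs of \<open>V\<close> alike, so the same price per edge holds for
  every complete graph on at least four vertices. Since \<open>q\<close> values are worth \<open>log 2 q\<close> bits, the exponent
  per edge, a limit by subadditivity, is at most \<open>log q ((q + 2) / 2)\<close>
  (\<open>exponent_per_edge_complete_graph_le\<close>). It remains to minimise this expression.
\<close>

section \<open>Rank of coefficient functions\<close>

text \<open>
  Tensors are treated as functions of a tuple of basis indices, one for each leg, on unrestricted index types.
  Passing to other index sets is then composition with a map at every leg, and tensor products are pointwise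
  products of such compositions.
\<close>

definition rank_le :: "'v set \<Rightarrow> (('v \<Rightarrow> 'b) \<Rightarrow> complex) \<Rightarrow> nat \<Rightarrow> bool" where
  "rank_le V F r \<longleftrightarrow>
     (\<exists>(I :: nat set) u. finite I \<and> card I \<le> r \<and> (\<forall>x. F x = (\<Sum>i\<in>I. \<Prod>v\<in>V. u i v (x v))))"

lemma rank_leI:
  assumes "finite I" "card I \<le> r" "\<And>x. F x = (\<Sum>i\<in>I. \<Prod>v\<in>V. u i v (x v))"
  shows "rank_le V F r"
proof -
  obtain h where h: "bij_betw h {..<card I} I"
    using ex_bij_betw_nat_finite[OF \<open>finite I\<close>] by (auto simp: atLeast0LessThan)
  have "F x = (\<Sum>i<card I. \<Prod>v\<in>V. u (h i) v (x v))" for x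
    unfolding assms(3) using sum.reindex_bij_betw[OF h, of "\<lambda>i. \<Prod>v\<in>V. u i v (x v)"] by simp
  thus ?thesis unfolding rank_le_def using assms(2)
    by (intro exI[of _ "{..<card I}"] exI[of _ "\<lambda>i. u (h i)"]) auto
qed

lemma rank_leE:
  assumes "rank_le V F r"
  obtains I :: "nat set" and u where "finite I" "card I \<le> r" "\<forall>x. F x = (\<Sum>i\<in>I. \<Prod>v\<in>V. u i v (x v))"
  using assms unfolding rank_le_def by blast

lemma rank_le_mono: "rank_le V F r \<Longrightarrow> r \<le> s \<Longrightarrow> rank_le V F s"
  unfolding rank_le_def using le_trans by blast

lemma rank_le_product: "rank_le V (\<lambda>x. \<Prod>v\<in>V. w v (x v)) 1"
  by (rule rank_leI[of "{()}" _ _ "\<lambda>_. w" V]) auto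

lemma rank_le_mult:
  assumes "rank_le V F r" "rank_le V G s"
  shows "rank_le V (\<lambda>x. F x * G x) (r * s)"
proof -
  obtain I u where I: "finite (I :: nat set)" "card I \<le> r" "\<forall>x. F x = (\<Sum>i\<in>I. \<Prod>v\<in>V. u i v (x v))"
    by (rule rank_leE[OF assms(1)])
  obtain J w where J: "finite (J :: nat set)" "card J \<le> s" "\<forall>x. G x = (\<Sum>i\<in>J. \<Prod>v\<in>V. w i v (x v))"
    by (rule rank_leE[OF assms(2)])
  have "F x * G x = (\<Sum>ij\<in>I \<times> J. \<Prod>v\<in>V. u (fst ij) v (x v) * w (snd ij) v (x v))" for x
    unfolding I(3)[rule_format] J(3)[rule_format] sum_product sum.cartesian_product by (simp add: prod.distrib case_prod_beta)
  thus ?thesis using I J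
    by (intro rank_leI[of "I \<times> J" _ _ "\<lambda>ij v b. u (fst ij) v b * w (snd ij) v b" V])
       (auto simp: card_cartesian_product mult_le_mono)
qed

text \<open>
  A map of basis indices at every leg is a special linear map, so it does not increase the rank. Together with
  multiplication by a product of 0/1-valued factors (zeroing out), this is the only kind of restriction that the
  construction of the decompositions uses.
\<close>

lemma rank_le_pullback:
  assumes "rank_le V F r"
  shows "rank_le V (\<lambda>x. F (\<lambda>v. g v (x v))) r"
proof -
  obtain I u where I: "finite (I :: nat set)" "card I \<le> r" "\<forall>x. F x = (\<Sum>i\<in>I. \<Prod>v\<in>V. u i v (x v))"
    by (rule rank_leE[OF assms])
  thus ?thesis by (intro rank_leI[of I _ _ "\<lambda>i v b. u i v (g v b)" V]) auto
qed

lemma rank_le_prod: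
  assumes "finite A" "\<And>a. a \<in> A \<Longrightarrow> rank_le V (F a) (r a)"
  shows "rank_le V (\<lambda>x. \<Prod>a\<in>A. F a x) (\<Prod>a\<in>A. r a)"
  using assms
proof (induction A rule: finite_induct)
  case empty
  show ?case using rank_le_product[of V "\<lambda>_ _. 1"] by simp
next
  case (insert a A)
  thus ?case by (simp add: rank_le_mult)
qed

lemma rank_le_sum:
  assumes "finite A" "\<And>a. a \<in> A \<Longrightarrow> rank_le V (F a) r"
  shows "rank_le V (\<lambda>x. \<Sum>a\<in>A. F a x) (card A * r)"
proof -
  have "\<forall>a\<in>A. \<exists>(I :: nat set) u. finite I \<and> card I \<le> r \<and> (\<forall>x. F a x = (\<Sum>i\<in>I. \<Prod>v\<in>V. u i v (x v)))"
    using assms(2) unfolding rank_le_def by blast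
  then obtain I u where I: "\<And>a. a \<in> A \<Longrightarrow> finite (I a :: nat set)" "\<And>a. a \<in> A \<Longrightarrow> card (I a) \<le> r"
    "\<And>a x. a \<in> A \<Longrightarrow> F a x = (\<Sum>i\<in>I a. \<Prod>v\<in>V. u a i v (x v))" by metis
  show ?thesis
  proof (rule rank_leI[of "Sigma A I" _ _ "\<lambda>(a, i). u a i" V])
    show "finite (Sigma A I)" using assms(1) I by auto
    show "card (Sigma A I) \<le> card A * r"
      using assms(1) I sum_mono[of A "\<lambda>a. card (I a)" "\<lambda>_. r"] by (simp add: card_SigmaI)
    show "(\<Sum>a\<in>A. F a x) = (\<Sum>i\<in>Sigma A I. \<Prod>v\<in>V. (case i of (a, i) \<Rightarrow> u a i) v (x v))" for x
    proof -
      have "(\<Sum>a\<in>A. F a x) = (\<Sum>a\<in>A. \<Sum>i\<in>I a. \<Prod>v\<in>V. u a i v (x v))"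
        using I by (intro sum.cong) auto
      also have "\<dots> = (\<Sum>i\<in>Sigma A I. \<Prod>v\<in>V. (case i of (a, i) \<Rightarrow> u a i) v (x v))"
        using assms(1) I by (subst sum.Sigma) (auto intro!: sum.cong)
      finally show ?thesis .
    qed
  qed
qed

lemma rank_le_add:
  assumes "rank_le V F r" "rank_le V G s"
  shows "rank_le V (\<lambda>x. F x + G x) (r + s)"
proof -
  obtain I u where I: "finite (I :: nat set)" "card I \<le> r" "\<forall>x. F x = (\<Sum>i\<in>I. \<Prod>v\<in>V. u i v (x v))"
    by (rule rank_leE[OF assms(1)])
  obtain J w where J: "finite (J :: nat set)" "card J \<le> s" "\<forall>x. G x = (\<Sum>i\<in>J. \<Prod>v\<in>V. w i v (x v))"
    by (rule rank_leE[OF assms(2)])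
  have "F x + G x = (\<Sum>i\<in>I <+> J. \<Prod>v\<in>V. (case i of Inl i \<Rightarrow> u i | Inr i \<Rightarrow> w i) v (x v))" for x
    using I J by (simp add: sum.Plus)
  thus ?thesis using I J
    by (intro rank_leI[of "I <+> J" _ _ "\<lambda>i. case i of Inl i \<Rightarrow> u i | Inr i \<Rightarrow> w i" V])
       (auto simp: card_Plus)
qed

text \<open>
  The scalar is absorbed by one of the legs.
\<close>

lemma rank_le_scale:
  assumes "rank_le V F r" "finite V" "V \<noteq> {}"
  shows "rank_le V (\<lambda>x. c * F x) r"
proof -
  obtain v0 where v0: "v0 \<in> V" using assms(3) by blast
  have "(\<Prod>v\<in>V. if v = v0 then c else 1) = c" using assms(2) v0 by (simp add: prod.delta)
  hence "rank_le V (\<lambda>_ :: 'a \<Rightarrow> 'b. c) 1"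
    using rank_le_product[of V "\<lambda>v _. if v = v0 then c else 1"] by simp
  from rank_le_mult[OF this assms(1)] show ?thesis by simp
qed

lemma rank_le_more_legs:
  assumes "rank_le S F r" "S \<subseteq> V" "finite V"
  shows "rank_le V F r"
proof -
  obtain I u where I: "finite (I :: nat set)" "card I \<le> r" "\<forall>x. F x = (\<Sum>i\<in>I. \<Prod>v\<in>S. u i v (x v))"
    by (rule rank_leE[OF assms(1)])
  have "(\<Prod>v\<in>S. u i v (x v)) = (\<Prod>v\<in>V. if v \<in> S then u i v (x v) else 1)" for i and x :: "'a \<Rightarrow> 'b"
    using assms(2,3) by (intro prod.mono_neutral_cong_left) auto
  thus ?thesis using I
    by (intro rank_leI[of I _ _ "\<lambda>i v b. if v \<in> S then u i v b else 1" V]) auto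
qed

text \<open>
  If \<open>F\<close> is a sum of \<open>r\<close> products, then \<open>F * G\<close> is a sum of \<open>r\<close> products times copies of \<open>G\<close>. Up to
  \<open>card \<Lambda>\<close> of these copies come from one direct sum of copies of \<open>G\<close>: contracting the summation index \<open>l\<close> at
  every leg with the factor of the \<open>l\<close>-th product at that leg turns the direct sum into
  \<open>\<Sum>l. (product l) * G\<close>, and it does not increase the rank \<open>R\<close>. The \<open>r\<close> products form \<open>t\<close> groups.
\<close>

lemma rank_le_mult_by_direct_sum:
  fixes F G :: "('v \<Rightarrow> 'b) \<Rightarrow> complex" and \<Lambda> :: "'l set"
  assumes V: "finite V" "V \<noteq> {}" and "finite \<Lambda>"
    and sum: "rank_le V (\<lambda>x. of_bool (\<exists>l\<in>\<Lambda>. \<forall>v\<in>V. fst (x v) = l) * G (\<lambda>v. snd (x v))) R"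
    and F: "rank_le V F r" and r: "r \<le> card \<Lambda> * t"
  shows "rank_le V (\<lambda>x. F x * G x) (R * t)"
proof -
  obtain I u where I: "finite (I :: nat set)" "card I \<le> r" "\<forall>x. F x = (\<Sum>i\<in>I. \<Prod>v\<in>V. u i v (x v))"
    by (rule rank_leE[OF F])
  obtain J w where J: "finite (J :: nat set)" "card J \<le> R"
    "\<forall>x. of_bool (\<exists>l\<in>\<Lambda>. \<forall>v\<in>V. fst (x v) = l) * G (\<lambda>v. snd (x v)) = (\<Sum>j\<in>J. \<Prod>v\<in>V. w j v (x v))"
    by (rule rank_leE[OF sum])
  have "card I \<le> card (\<Lambda> \<times> {..<t})" using I(2) r by (simp add: card_cartesian_product)
  then obtain h where h: "h ` I \<subseteq> \<Lambda> \<times> {..<t}" "inj_on h I"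
    using card_le_inj[OF I(1), of "\<Lambda> \<times> {..<t}"] \<open>finite \<Lambda>\<close> by auto
  \<comment> \<open>\<open>h\<close> arranges the products in \<open>t\<close> groups \<open>K a\<close> and injects each group into \<open>\<Lambda>\<close>.\<close>
  define K where "K = (\<lambda>a. {i \<in> I. snd (h i) = a})"
  have K: "finite (K a)" for a using I(1) by (simp add: K_def)
  have step: "rank_le V (\<lambda>x. (\<Sum>i\<in>K a. \<Prod>v\<in>V. u i v (x v)) * G x) R" for a
  proof (rule rank_leI[of J _ _ "\<lambda>j v b. \<Sum>i\<in>K a. u i v b * w j v (fst (h i), b)" V])
    fix x :: "'v \<Rightarrow> 'b"
    have diag: "of_bool (\<exists>l\<in>\<Lambda>. \<forall>v\<in>V. fst (h (g v)) = l) = (of_bool (\<exists>i\<in>K a. g = restrict (\<lambda>_. i) V) :: complex)"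
      if g: "g \<in> V \<rightarrow>\<^sub>E K a" for g
    proof -
      have "(\<exists>l\<in>\<Lambda>. \<forall>v\<in>V. fst (h (g v)) = l) \<longleftrightarrow> (\<exists>i\<in>K a. g = restrict (\<lambda>_. i) V)"
      proof
        assume "\<exists>l\<in>\<Lambda>. \<forall>v\<in>V. fst (h (g v)) = l"
        then obtain l where l: "\<forall>v\<in>V. fst (h (g v)) = l" by blast
        obtain v0 where v0: "v0 \<in> V" using V by blast
        have gK: "g v \<in> K a" if "v \<in> V" for v using g that by (rule PiE_mem)
        have "g v = g v0" if "v \<in> V" for v
        proof (rule inj_onD[OF h(2)])
          have "snd (h (g v)) = snd (h (g v0))" using gK[OF that] gK[OF v0] by (simp add: K_def)
          thus "h (g v) = h (g v0)" using l that v0 by (simp add: prod_eq_iff)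
          show "g v \<in> I" "g v0 \<in> I" using gK[OF that] gK[OF v0] by (simp_all add: K_def)
        qed
        hence "g = restrict (\<lambda>_. g v0) V"
          using g by (intro extensionalityI[of _ V]) (auto simp: PiE_def)
        thus "\<exists>i\<in>K a. g = restrict (\<lambda>_. i) V" using gK[OF v0] by blast
      next
        assume "\<exists>i\<in>K a. g = restrict (\<lambda>_. i) V"
        then obtain i where i: "i \<in> K a" "g = restrict (\<lambda>_. i) V" by blast
        hence "fst (h i) \<in> \<Lambda>" using h(1) unfolding K_def by (metis (no_types, lifting) image_subset_iff mem_Collect_eq mem_Sigma_iff prod.collapse)
        thus "\<exists>l\<in>\<Lambda>. \<forall>v\<in>V. fst (h (g v)) = l" using i(2) by auto
      qed
      thus ?thesis by simp
    qed
    have fin: "finite (V \<rightarrow>\<^sub>E K a)" using V K by (intro finite_PiE) auto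
    have inj: "inj_on (\<lambda>i. restrict (\<lambda>_. i) V) (K a)"
      using V by (auto simp: inj_on_def restrict_def fun_eq_iff)
    have "(\<Sum>j\<in>J. \<Prod>v\<in>V. \<Sum>i\<in>K a. u i v (x v) * w j v (fst (h i), x v)) =
          (\<Sum>j\<in>J. \<Sum>g\<in>V \<rightarrow>\<^sub>E K a. (\<Prod>v\<in>V. u (g v) v (x v)) * (\<Prod>v\<in>V. w j v (fst (h (g v)), x v)))"
      using V K by (subst prod_sum_PiE) (auto simp: prod.distrib)
    also have "\<dots> = (\<Sum>g\<in>V \<rightarrow>\<^sub>E K a. (\<Prod>v\<in>V. u (g v) v (x v)) *
                       (\<Sum>j\<in>J. \<Prod>v\<in>V. w j v (fst (h (g v)), x v)))"
      by (subst sum.swap) (simp add: sum_distrib_left)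
    also have "\<dots> = (\<Sum>g\<in>V \<rightarrow>\<^sub>E K a. (\<Prod>v\<in>V. u (g v) v (x v)) *
                       (of_bool (\<exists>l\<in>\<Lambda>. \<forall>v\<in>V. fst (h (g v)) = l) * G x))"
    proof (intro sum.cong refl)
      fix g
      show "(\<Prod>v\<in>V. u (g v) v (x v)) * (\<Sum>j\<in>J. \<Prod>v\<in>V. w j v (fst (h (g v)), x v)) =
            (\<Prod>v\<in>V. u (g v) v (x v)) * (of_bool (\<exists>l\<in>\<Lambda>. \<forall>v\<in>V. fst (h (g v)) = l) * G x)"
        unfolding J(3)[rule_format, of "\<lambda>v. (fst (h (g v)), x v)", symmetric] by simp
    qed
    also have "\<dots> = (\<Sum>g\<in>V \<rightarrow>\<^sub>E K a. if g \<in> (\<lambda>i. restrict (\<lambda>_. i) V) ` K a then (\<Prod>v\<in>V. u (g v) v (x v)) * G x else 0)"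
      by (intro sum.cong refl) (auto simp: diag)
    also have "\<dots> = (\<Sum>g\<in>(\<lambda>i. restrict (\<lambda>_. i) V) ` K a. (\<Prod>v\<in>V. u (g v) v (x v)) * G x)"
      using fin by (subst sum.inter_restrict [symmetric]) (auto intro!: sum.cong)
    also have "\<dots> = (\<Sum>i\<in>K a. (\<Prod>v\<in>V. u i v (x v)) * G x)"
      by (subst sum.reindex[OF inj]) (auto intro!: sum.cong prod.cong)
    finally show "(\<Sum>i\<in>K a. \<Prod>v\<in>V. u i v (x v)) * G x =
        (\<Sum>j\<in>J. \<Prod>v\<in>V. \<Sum>i\<in>K a. u i v (x v) * w j v (fst (h i), x v))"
      by (simp add: sum_distrib_right)
  qed (use J in auto)
  have "F x * G x = (\<Sum>a<t. (\<Sum>i\<in>K a. \<Prod>v\<in>V. u i v (x v)) * G x)" for x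
  proof -
    have "F x = (\<Sum>a<t. \<Sum>i\<in>K a. \<Prod>v\<in>V. u i v (x v))"
      unfolding I(3)[rule_format] K_def using h(1) I(1) by (intro sum.group [symmetric]) auto
    thus ?thesis by (simp add: sum_distrib_right)
  qed
  moreover have "rank_le V (\<lambda>x. \<Sum>a<t. (\<Sum>i\<in>K a. \<Prod>v\<in>V. u i v (x v)) * G x) (card {..<t} * R)"
    by (intro rank_le_sum step) auto
  ultimately show ?thesis by (simp add: mult.commute)
qed

section \<open>A four-legged Coppersmith--Winograd tensor\<close>

lemma prod_of_bool:
  "finite A \<Longrightarrow> (\<Prod>v\<in>A. of_bool (P v)) = (of_bool (\<forall>v\<in>A. P v) :: 'a :: comm_semiring_1)"
  by (induction A rule: finite_induct) auto

text \<open>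
  Averaging over the roots of unity extracts the constant coefficient, since all other powers cancel.
\<close>

lemma sum_roots_of_unity_poly:
  fixes P :: "complex poly"
  assumes "degree P < K"
  shows "(\<Sum>k<K. poly P (cis (2 * pi * real k / real K))) = of_nat K * poly P 0"
proof -
  define \<omega> where "\<omega> = (\<lambda>k. cis (2 * pi * real k / real K))"
  have inj: "inj_on \<omega> {..<K}" and img: "\<omega> ` {..<K} = {z. z ^ K = 1}"
    using bij_betw_roots_unity[of K] assms by (auto simp: bij_betw_def \<omega>_def)
  have pow: "\<omega> k ^ i = \<omega> i ^ k" for k i
    by (simp add: \<omega>_def DeMoivre mult_ac)
  have geom: "(\<Sum>k<K. \<omega> k ^ i) = (if i = 0 then of_nat K else 0)" if "i < K" for i
  proof (cases "i = 0")
    case False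
    have "\<omega> i \<noteq> \<omega> 0" using inj_onD[OF inj, of i 0] that False by auto
    hence "\<omega> i \<noteq> 1" by (simp add: \<omega>_def)
    moreover have "\<omega> i ^ K = 1" using img that by blast
    ultimately show ?thesis using False by (simp add: pow[of _ i] geometric_sum)
  qed simp
  have "(\<Sum>k<K. poly P (\<omega> k)) = (\<Sum>i\<le>degree P. coeff P i * (\<Sum>k<K. \<omega> k ^ i))"
    by (simp add: poly_altdef sum_distrib_left) (rule sum.swap)
  also have "\<dots> = (\<Sum>i\<le>degree P. if i = 0 then coeff P i * of_nat K else 0)"
    using assms by (intro sum.cong refl) (auto simp: geom)
  also have "\<dots> = of_nat K * poly P 0" by (simp add: poly_0_coeff_0)
  finally show ?thesis by (simp add: \<omega>_def)
qed

definition cw_tensor :: "'v set \<Rightarrow> nat \<Rightarrow> ('v \<Rightarrow> nat) \<Rightarrow> complex" where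
  "cw_tensor S q x =
     of_bool (\<exists>e\<in>complete_edges S. \<exists>i\<in>{1..q}. \<forall>v\<in>S. x v = (if v \<in> e then i else 0))"

text \<open>
  If \<open>m\<close> legs have a nonzero index, this is the polynomial in \<open>\<epsilon>\<close> that the combination of rank-one tensors in
  \<open>rank_le_cw_poly\<close> evaluates to. All coefficients of negative powers of \<open>\<epsilon>\<close> have cancelled; only \<open>m = 2\<close>
  contributes a constant term.
\<close>

definition cw_poly :: "'v set \<Rightarrow> nat \<Rightarrow> ('v \<Rightarrow> nat) \<Rightarrow> complex poly" where
  "cw_poly S q x = (let A = {v\<in>S. x v \<noteq> 0}; m = card A in
     if m < 2 \<or> (\<exists>v\<in>S. q < x v) then 0
     else smult (of_bool (\<exists>i\<in>{1..q}. \<forall>v\<in>A. x v = i)) (monom 1 (m - 2)) - monom 1 (2 * m - 3))"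

lemma poly_cw_poly_0:
  assumes "finite S"
  shows "poly (cw_poly S q x) 0 = cw_tensor S q x"
proof -
  define A where "A = {v\<in>S. x v \<noteq> 0}"
  define m where "m = card A"
  have fin: "finite A" using assms by (simp add: A_def)
  have *: "(\<exists>e\<in>complete_edges S. \<exists>i\<in>{1..q}. \<forall>v\<in>S. x v = (if v \<in> e then i else 0)) \<longleftrightarrow>
           m = 2 \<and> \<not> (\<exists>v\<in>S. q < x v) \<and> (\<exists>i\<in>{1..q}. \<forall>v\<in>A. x v = i)"
  proof
    assume "\<exists>e\<in>complete_edges S. \<exists>i\<in>{1..q}. \<forall>v\<in>S. x v = (if v \<in> e then i else 0)"
    then obtain e i where e: "e \<subseteq> S" "card e = 2" "i \<in> {1..q}" "\<forall>v\<in>S. x v = (if v \<in> e then i else 0)"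
      by (auto simp: complete_edges_def)
    hence "A = e" by (auto simp: A_def split: if_splits)
    thus "m = 2 \<and> \<not> (\<exists>v\<in>S. q < x v) \<and> (\<exists>i\<in>{1..q}. \<forall>v\<in>A. x v = i)"
      using e by (auto simp: m_def intro!: bexI[of _ i])
  next
    assume R: "m = 2 \<and> \<not> (\<exists>v\<in>S. q < x v) \<and> (\<exists>i\<in>{1..q}. \<forall>v\<in>A. x v = i)"
    then obtain i where "i \<in> {1..q}" "\<forall>v\<in>A. x v = i" by blast
    thus "\<exists>e\<in>complete_edges S. \<exists>i\<in>{1..q}. \<forall>v\<in>S. x v = (if v \<in> e then i else 0)"
      using R by (intro bexI[of _ A] bexI[of _ i]) (auto simp: A_def m_def complete_edges_def)
  qed
  show ?thesis unfolding cw_tensor_def * unfolding cw_poly_def Let_def A_def [symmetric] m_def [symmetric]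
    by (auto simp: poly_monom power_0_left)
qed

lemma degree_cw_poly:
  assumes "finite S"
  shows "degree (cw_poly S q x) \<le> 2 * card S"
proof -
  define m where "m = card {v\<in>S. x v \<noteq> 0}"
  have "m \<le> card S" using assms by (auto simp: m_def intro: card_mono)
  hence "degree (smult c (monom 1 (m - 2)) - monom 1 (2 * m - 3) :: complex poly) \<le> 2 * card S" for c
    by (intro degree_diff_le order_trans[OF degree_smult_le] order_trans[OF degree_monom_le]) auto
  thus ?thesis by (auto simp: cw_poly_def Let_def m_def)
qed

text \<open>
  Up to terms that vanish as \<open>\<epsilon>\<close> tends to 0, \<open>cw_tensor\<close> is
  \<open>(\<Sum>i. (b\<^sub>0 + \<epsilon> b\<^sub>i)\<^bsup>\<otimes>S\<^esup>) / \<epsilon>\<^sup>2 - (b\<^sub>0 + \<epsilon>\<^sup>2 (\<Sum>i. b\<^sub>i))\<^bsup>\<otimes>S\<^esup> / \<epsilon>\<^sup>3 + (1 / \<epsilon>\<^sup>3 - q / \<epsilon>\<^sup>2) b\<^sub>0\<^bsup>\<otimes>S\<^esup>\<close>.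
  In terms of the number \<open>m\<close> of nonzero indices, the first sum contributes \<open>\<epsilon> ^ (m - 2)\<close> if these indices
  agree, and the second power contributes \<open>\<epsilon> ^ (2 * m - 3)\<close>. They cancel for \<open>m = 1\<close>, and the last term removes
  what is left for \<open>m = 0\<close>.
\<close>

lemma rank_le_cw_poly:
  assumes S: "finite S" "S \<noteq> {}" and \<epsilon>: "\<epsilon> \<noteq> 0"
  shows "rank_le S (\<lambda>x. poly (cw_poly S q x) \<epsilon>) (q + 2)"
proof -
  define f where "f = (\<lambda>x. (\<Sum>i\<in>{1..q}. inverse (\<epsilon> ^ 2) * (\<Prod>v\<in>S. of_bool (x v = 0) + \<epsilon> * of_bool (x v = i)))
      + (- inverse (\<epsilon> ^ 3) * (\<Prod>v\<in>S. if x v = 0 then 1 else if x v \<le> q then \<epsilon> ^ 2 else 0)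
      + (inverse (\<epsilon> ^ 3) - of_nat q * inverse (\<epsilon> ^ 2)) * (\<Prod>v\<in>S. of_bool (x v = 0))))"
  have "rank_le S f (card {1..q} * 1 + (1 + 1))"
    unfolding f_def
    by (intro rank_le_add rank_le_sum rank_le_scale[OF _ S]
          rank_le_product[of S "\<lambda>_ b. of_bool (b = 0) + \<epsilon> * of_bool (b = _)"]
          rank_le_product[of S "\<lambda>_ b. if b = 0 then 1 else if b \<le> q then \<epsilon> ^ 2 else 0"]
          rank_le_product[of S "\<lambda>_ b. of_bool (b = 0)"] finite_atLeastAtMost)
  moreover have "f x = poly (cw_poly S q x) \<epsilon>" for x
  proof (cases "\<exists>v\<in>S. q < x v")
    case True
    then obtain v where v: "v \<in> S" "q < x v" by blast
    have "(\<Prod>v\<in>S. of_bool (x v = 0) + \<epsilon> * of_bool (x v = i)) = 0" if "i \<in> {1..q}" for i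
      using S v that by (auto intro!: prod_zero bexI[of _ v])
    moreover have "(\<Prod>v\<in>S. if x v = 0 then 1 else if x v \<le> q then \<epsilon> ^ 2 else 0) = 0"
      using S v by (auto intro!: prod_zero bexI[of _ v])
    moreover have "(\<Prod>v\<in>S. of_bool (x v = 0) :: complex) = 0"
      using S v by (auto intro!: prod_zero bexI[of _ v])
    ultimately show ?thesis using v by (auto simp: f_def cw_poly_def Let_def)
  next
    case False
    define A where "A = {v\<in>S. x v \<noteq> 0}"
    define m where "m = card A"
    have A: "finite A" "A \<subseteq> S" using S by (auto simp: A_def)
    have 1: "(\<Prod>v\<in>S. of_bool (x v = 0) + \<epsilon> * of_bool (x v = i)) = \<epsilon> ^ m * of_bool (\<forall>v\<in>A. x v = i)"
      if "i \<in> {1..q}" for i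
    proof -
      have "(\<Prod>v\<in>S. of_bool (x v = 0) + \<epsilon> * of_bool (x v = i)) = (\<Prod>v\<in>A. \<epsilon> * of_bool (x v = i))"
        using S A that by (intro prod.mono_neutral_cong_right) (auto simp: A_def)
      thus ?thesis using A by (simp add: prod.distrib prod_of_bool m_def)
    qed
    have 2: "(\<Prod>v\<in>S. if x v = 0 then 1 else if x v \<le> q then \<epsilon> ^ 2 else 0) = (\<epsilon> ^ 2) ^ m"
    proof -
      have "(\<Prod>v\<in>S. if x v = 0 then 1 else if x v \<le> q then \<epsilon> ^ 2 else 0) = (\<Prod>v\<in>A. \<epsilon> ^ 2)"
        using S A False by (intro prod.mono_neutral_cong_right) (auto simp: A_def not_less)
      thus ?thesis by (simp add: m_def)
    qed
    have 3: "(\<Prod>v\<in>S. of_bool (x v = 0)) = (of_bool (m = 0) :: complex)"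
      using S A by (auto simp: prod_of_bool m_def A_def)
    have f: "f x = inverse (\<epsilon> ^ 2) * \<epsilon> ^ m * (\<Sum>i\<in>{1..q}. of_bool (\<forall>v\<in>A. x v = i))
      + (- inverse (\<epsilon> ^ 3) * (\<epsilon> ^ 2) ^ m + (inverse (\<epsilon> ^ 3) - of_nat q * inverse (\<epsilon> ^ 2)) * of_bool (m = 0))"
      unfolding f_def 2 3 sum_distrib_left by (intro arg_cong2[of _ _ _ _ "(+)"] sum.cong refl) (simp add: 1)
    define E where "E = (of_bool (\<exists>i\<in>{1..q}. \<forall>v\<in>A. x v = i) :: complex)"
    show ?thesis
    proof (cases "m = 0")
      case True
      hence "A = {}" using A by (simp add: m_def)
      hence "f x = 0" unfolding f using \<epsilon> True by (simp add: field_simps)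
      thus ?thesis using True by (simp add: cw_poly_def Let_def A_def m_def)
    next
      case m0: False
      then obtain a where a: "a \<in> A" using A by (auto simp: m_def)
      have "(\<Sum>i\<in>{1..q}. of_bool (\<forall>v\<in>A. x v = i)) = (\<Sum>i\<in>{1..q}. if i = x a then E else 0)"
        using a by (intro sum.cong refl) (auto simp: E_def)
      also have "\<dots> = E"
        using a False by (auto simp: sum.delta E_def A_def not_less)
      finally have f': "f x = inverse (\<epsilon> ^ 2) * \<epsilon> ^ m * E - inverse (\<epsilon> ^ 3) * (\<epsilon> ^ 2) ^ m"
        using m0 unfolding f by simp
      show ?thesis
      proof (cases "m = 1")
        case True
        then obtain b where b: "A = {b}" by (auto simp: m_def card_1_singleton_iff)
        hence "E = 1" using False by (auto simp: E_def A_def not_less)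
        hence "f x = 0" unfolding f' using \<epsilon> True by (simp add: field_simps power2_eq_square power3_eq_cube)
        thus ?thesis using True by (simp add: cw_poly_def Let_def A_def m_def)
      next
        case m1: False
        hence m: "m \<ge> 2" using m0 by simp
        have "inverse (\<epsilon> ^ 2) * \<epsilon> ^ m = \<epsilon> ^ (m - 2)" "inverse (\<epsilon> ^ 3) * \<epsilon> ^ (2 * m) = \<epsilon> ^ (2 * m - 3)"
          using m \<epsilon> by (simp_all add: power_diff field_simps)
        hence "f x = E * \<epsilon> ^ (m - 2) - \<epsilon> ^ (2 * m - 3)" unfolding f' by (simp add: power_mult)
        thus ?thesis using m False unfolding cw_poly_def Let_def A_def [symmetric] m_def [symmetric] E_def [symmetric]
          by (simp add: poly_monom)
      qed
    qed
  qed
  ultimately have "rank_le S f (q + 2)" and "f = (\<lambda>x. poly (cw_poly S q x) \<epsilon>)" by auto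
  thus ?thesis by simp
qed

text \<open>
  The \<open>N\<close>-th power of the approximation is a polynomial of degree less than \<open>K = 2 * card S * N + 1\<close> in \<open>\<epsilon>\<close> with
  the \<open>N\<close>-th power of \<open>cw_tensor\<close> as its constant term. That term is the average over the \<open>K\<close>-th roots of unity,
  each of which contributes rank \<open>(q + 2) ^ N\<close>.
\<close>

lemma rank_le_cw_power:
  assumes S: "finite S" "S \<noteq> {}"
  shows "rank_le S (\<lambda>x. \<Prod>j<N. cw_tensor S q (\<lambda>v. x v j)) ((2 * card S * N + 1) * (q + 2) ^ N)"
proof -
  define K where "K = 2 * card S * N + 1"
  define P where "P = (\<lambda>x. \<Prod>j<N. cw_poly S q (\<lambda>v. x v j))"
  have deg: "degree (P x) < K" for x
  proof -
    have "degree (P x) \<le> (\<Sum>j<N. 2 * card S)"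
      unfolding P_def
      by (rule order_trans[OF degree_prod_sum_le[OF finite_lessThan]], rule sum_mono)
         (simp add: degree_cw_poly[OF S(1)])
    thus ?thesis by (simp add: K_def mult_ac)
  qed
  have eq: "(\<Prod>j<N. cw_tensor S q (\<lambda>v. x v j)) =
        inverse (of_nat K) * (\<Sum>k<K. poly (P x) (cis (2 * pi * real k / real K)))" for x
    unfolding sum_roots_of_unity_poly[OF deg] using S by (simp add: P_def poly_prod poly_cw_poly_0 K_def del: of_nat_add of_nat_mult of_nat_Suc)
  have "rank_le S (\<lambda>x. poly (P x) (cis \<theta>)) ((q + 2) ^ N)" for \<theta>
  proof -
    have "rank_le S (\<lambda>x. \<Prod>j<N. poly (cw_poly S q (\<lambda>v. x v j)) (cis \<theta>)) (\<Prod>j<N. q + 2)"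
      by (intro rank_le_prod finite_lessThan
            rank_le_pullback[of S "\<lambda>x. poly (cw_poly S q x) (cis \<theta>)" _ "\<lambda>_ b. b _"] rank_le_cw_poly S cis_neq_zero)
    thus ?thesis by (simp add: P_def poly_prod)
  qed
  hence "rank_le S (\<lambda>x. inverse (of_nat K) * (\<Sum>k<K. poly (P x) (cis (2 * pi * real k / real K)))) (card {..<K} * (q + 2) ^ N)"
    by (intro rank_le_scale rank_le_sum S) auto
  thus ?thesis unfolding eq by (simp add: K_def)
qed

section \<open>Hashing words of pairs\<close>

lemma complete_edges_four:
  assumes "distinct [a, b, c, d]"
  shows "complete_edges {a, b, c, d} = {{a, b}, {a, c}, {a, d}, {b, c}, {b, d}, {c, d}}"
proof
  show "complete_edges {a, b, c, d} \<subseteq> {{a, b}, {a, c}, {a, d}, {b, c}, {b, d}, {c, d}}"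
  proof
    fix e assume "e \<in> complete_edges {a, b, c, d}"
    then obtain x y where e: "e = {x, y}" "x \<noteq> y" "x \<in> {a, b, c, d}" "y \<in> {a, b, c, d}"
      unfolding complete_edges_def card_2_iff by blast
    show "e \<in> {{a, b}, {a, c}, {a, d}, {b, c}, {b, d}, {c, d}}"
      using e(3,4) e(2) unfolding e(1) by (elim insertE emptyE) (simp_all add: insert_commute)
  qed
  show "{{a, b}, {a, c}, {a, d}, {b, c}, {b, d}, {c, d}} \<subseteq> complete_edges {a, b, c, d}"
    using assms by (simp add: complete_edges_def)
qed

lemma finite_complete_edges: "finite V \<Longrightarrow> finite (complete_edges V)"
  by (simp add: complete_edges_def)

lemma card_complete_edges: "finite V \<Longrightarrow> card (complete_edges V) = card V choose 2"
  by (simp add: complete_edges_def n_subsets)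

lemma four_set_with_pair:
  assumes "card S = 4" "v \<in> S" "w \<in> S" "v \<noteq> w"
  obtains c d where "S = {v, w, c, d}" "distinct [v, w, c, d]"
proof -
  have fin: "finite S" using assms(1) by (metis card.infinite zero_neq_numeral)
  have "card (S - {v, w}) = 2" using assms fin by (subst card_Diff_subset) auto
  then obtain c d where "S - {v, w} = {c, d}" "c \<noteq> d" by (auto simp: card_2_iff)
  thus thesis using assms by (intro that[of c d]) auto
qed

lemma card_pairs_matching_one:
  assumes "card S = 4" "v \<in> S"
  shows "card {e \<in> complete_edges S. v \<in> e \<longleftrightarrow> X} = 3"
proof -
  have fin: "finite S" using assms(1) by (metis card.infinite zero_neq_numeral)
  have "card (S - {v}) = 3" using assms fin by simp
  hence "S - {v} \<noteq> {}" by (intro notI) simp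
  then obtain w where w: "w \<in> S" "v \<noteq> w" by blast
  obtain c d where S: "S = {v, w, c, d}" and dist: "distinct [v, w, c, d]"
    by (rule four_set_with_pair[OF assms(1,2) w])
  have "{e \<in> complete_edges S. v \<in> e \<longleftrightarrow> X} = (if X then {{v, w}, {v, c}, {v, d}} else {{w, c}, {w, d}, {c, d}})"
    unfolding S complete_edges_four[OF dist] using dist by auto
  thus ?thesis using dist by (auto simp: doubleton_eq_iff)
qed

text \<open>
  Once the membership of two legs is prescribed, there is a choice left only if exactly one of them belongs to the
  pair. This makes words that agree on two legs rare enough for the hashing argument.
\<close>

lemma card_pairs_matching_two:
  assumes "card S = 4" "v \<in> S" "w \<in> S" "v \<noteq> w"
  shows "card {e \<in> complete_edges S. (v \<in> e \<longleftrightarrow> X) \<and> (w \<in> e \<longleftrightarrow> Y)} = (if X = Y then 1 else 2)"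
    and "card {e \<in> complete_edges S. (v \<in> e) \<noteq> (w \<in> e)} = 4"
proof -
  obtain c d where S: "S = {v, w, c, d}" and dist: "distinct [v, w, c, d]"
    by (rule four_set_with_pair[OF assms])
  have "{e \<in> complete_edges S. (v \<in> e \<longleftrightarrow> X) \<and> (w \<in> e \<longleftrightarrow> Y)} =
     (if X then if Y then {{v, w}} else {{v, c}, {v, d}} else if Y then {{w, c}, {w, d}} else {{c, d}})"
    unfolding S complete_edges_four[OF dist] using dist by auto
  thus "card {e \<in> complete_edges S. (v \<in> e \<longleftrightarrow> X) \<and> (w \<in> e \<longleftrightarrow> Y)} = (if X = Y then 1 else 2)"
    using dist by (auto simp: doubleton_eq_iff)
  have "{e \<in> complete_edges S. (v \<in> e) \<noteq> (w \<in> e)} = {{v, c}, {v, d}, {w, c}, {w, d}}"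
    unfolding S complete_edges_four[OF dist] using dist by auto
  thus "card {e \<in> complete_edges S. (v \<in> e) \<noteq> (w \<in> e)} = 4"
    using dist by (auto simp: doubleton_eq_iff)
qed

lemma ex_ge_average:
  fixes f :: "'a \<Rightarrow> real"
  assumes "finite A" "A \<noteq> {}"
  shows "\<exists>a\<in>A. (\<Sum>a\<in>A. f a) \<le> real (card A) * f a"
proof (rule ccontr)
  assume "\<not> ?thesis"
  hence "(\<Sum>b\<in>A. real (card A) * f b) < (\<Sum>b\<in>A. \<Sum>a\<in>A. f a)"
    using assms by (intro sum_strict_mono) (auto simp: not_le)
  thus False by (simp add: sum_distrib_left [symmetric])
qed

text \<open>
  A word of \<open>N\<close> pairs determines at every leg a 0/1-vector, its support. A random linear map to \<open>n\<close> residues modulo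
  \<open>p\<close> (the key), followed by a random translation at every leg but \<open>root\<close> (the shift), hashes these vectors. A word is
  retained if all its hashes at legs other than \<open>root\<close> are equal to one point of a sphere in \<open>{0..m} ^ n\<close>. As the
  four supports of a word add up to the constant 2, the support at \<open>root\<close> determines the sum of the other three
  hashes. The bound on \<open>m\<close> prevents sums of three coordinates from wrapping around.
\<close>

locale pair_hashing =
  fixes S :: "'v set" and root :: 'v and N n m p :: nat
  assumes card_S: "card S = 4" and root: "root \<in> S" and p: "3 * m < p"
begin

definition patterns :: "(nat \<Rightarrow> 'v set) set" where
  "patterns = {..<N} \<rightarrow>\<^sub>E complete_edges S"

definition same_support :: "'v \<Rightarrow> (nat \<Rightarrow> 'v set) \<Rightarrow> (nat \<Rightarrow> 'v set) \<Rightarrow> bool" where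
  "same_support v z z' \<longleftrightarrow> (\<forall>j<N. v \<in> z j \<longleftrightarrow> v \<in> z' j)"

definition keys :: "(nat \<Rightarrow> nat \<Rightarrow> nat) set" where
  "keys = {..<n} \<rightarrow>\<^sub>E ({..<N} \<rightarrow>\<^sub>E {..<p})"

definition shifts :: "('v \<Rightarrow> nat \<Rightarrow> nat) set" where
  "shifts = (S - {root}) \<rightarrow>\<^sub>E ({..<n} \<rightarrow>\<^sub>E {..<p})"

definition sphere :: "nat \<Rightarrow> (nat \<Rightarrow> nat) set" where
  "sphere \<rho> = {b \<in> {..<n} \<rightarrow>\<^sub>E {..m}. (\<Sum>i<n. (b i)\<^sup>2) = \<rho>}"

definition weight :: "(nat \<Rightarrow> nat) \<Rightarrow> 'v \<Rightarrow> (nat \<Rightarrow> 'v set) \<Rightarrow> nat" where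
  "weight x v z = (\<Sum>j<N. x j * of_bool (v \<in> z j))"

definition hits :: "(nat \<Rightarrow> nat \<Rightarrow> nat) \<Rightarrow> ('v \<Rightarrow> nat \<Rightarrow> nat) \<Rightarrow> (nat \<Rightarrow> nat) \<Rightarrow> (nat \<Rightarrow> 'v set) \<Rightarrow> bool" where
  "hits c s b z \<longleftrightarrow> (\<forall>v\<in>S - {root}. \<forall>i<n. (s v i + weight (c i) v z) mod p = b i)"

lemma finite_S: "finite S" using card_S by (metis card.infinite zero_neq_numeral)

lemma card_nonroot: "card (S - {root}) = 3" using card_S root finite_S by simp

lemma p_pos: "p > 0" using p by simp

lemma finite_patterns: "finite patterns"
  unfolding patterns_def by (intro finite_PiE finite_complete_edges finite_S) auto

lemma patternsD: "z \<in> patterns \<Longrightarrow> j < N \<Longrightarrow> z j \<subseteq> S \<and> card (z j) = 2"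
  by (auto simp: patterns_def complete_edges_def PiE_iff)

lemma weight_cong: "same_support v z z' \<Longrightarrow> weight x v z = weight x v z'"
  by (simp add: weight_def same_support_def)

lemma sum_weight_nonroot:
  assumes "z \<in> patterns"
  shows "(\<Sum>v\<in>S - {root}. weight x v z) + weight x root z = 2 * (\<Sum>j<N. x j)"
proof -
  have "(\<Sum>v\<in>S - {root}. weight x v z) + weight x root z = (\<Sum>v\<in>S. weight x v z)"
    using finite_S root by (simp add: sum.remove add.commute)
  also have "\<dots> = (\<Sum>j<N. x j * (\<Sum>v\<in>S. of_bool (v \<in> z j)))"
    unfolding weight_def by (subst sum.swap) (simp add: sum_distrib_left)
  also have "\<dots> = (\<Sum>j<N. x j * 2)"
  proof (intro sum.cong refl)
    fix j assume "j \<in> {..<N}"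
    hence "z j \<subseteq> S" "card (z j) = 2" using patternsD[OF assms] by auto
    thus "x j * (\<Sum>v\<in>S. of_bool (v \<in> z j)) = x j * 2"
      using finite_S by (simp add: Int_absorb1)
  qed
  finally show ?thesis by (simp add: sum_distrib_left mult.commute)
qed

text \<open>
  The support at \<open>root\<close> and the parameters alone determine \<open>3 * b\<close>, so they determine \<open>b\<close>.
\<close>

lemma sum_of_hits:
  assumes "z \<in> patterns" "hits c s b z" "i < n"
  shows "[3 * b i + weight (c i) root z = (\<Sum>v\<in>S - {root}. s v i) + 2 * (\<Sum>j<N. c i j)] (mod p)"
proof -
  have "3 * b i = (\<Sum>v\<in>S - {root}. (s v i + weight (c i) v z) mod p)"
    using assms(2,3) card_nonroot by (simp add: hits_def)
  hence "[3 * b i = (\<Sum>v\<in>S - {root}. s v i + weight (c i) v z)] (mod p)"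
    by (simp add: cong_def mod_sum_eq)
  hence "[3 * b i + weight (c i) root z = (\<Sum>v\<in>S - {root}. s v i + weight (c i) v z) + weight (c i) root z] (mod p)"
    by (rule cong_add[OF _ cong_refl])
  thus ?thesis using sum_weight_nonroot[OF assms(1), of "c i"] by (simp add: sum.distrib add.assoc)
qed

lemma equal_targets_if_shared_leg:
  assumes "z \<in> patterns" "z' \<in> patterns" "hits c s b z" "hits c s b' z'"
    and b: "b \<in> sphere \<rho>" "b' \<in> sphere \<rho>" and v: "v \<in> S" "same_support v z z'"
  shows "b = b'"
proof (rule PiE_ext)
  show "b \<in> {..<n} \<rightarrow>\<^sub>E {..m}" "b' \<in> {..<n} \<rightarrow>\<^sub>E {..m}" using b by (simp_all add: sphere_def)
  fix i assume i: "i \<in> {..<n}"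
  have le: "b i \<le> m" "b' i \<le> m" using b i by (auto simp: sphere_def PiE_iff)
  show "b i = b' i"
  proof (cases "v = root")
    case True
    have "[3 * b i + weight (c i) root z = 3 * b' i + weight (c i) root z'] (mod p)"
      using i by (intro cong_trans[OF sum_of_hits[OF assms(1,3)] cong_sym[OF sum_of_hits[OF assms(2,4)]]]) auto
    hence "[3 * b i = 3 * b' i] (mod p)"
      using weight_cong[OF v(2)] True by (simp add: cong_add_rcancel_nat)
    thus ?thesis using le p by (simp add: cong_def)
  next
    case False
    hence "b i = (s v i + weight (c i) v z) mod p" "b' i = (s v i + weight (c i) v z') mod p"
      using assms(3,4) i v(1) by (auto simp: hits_def)
    thus ?thesis using weight_cong[OF v(2)] by simp
  qed
qed

text \<open>
  Here the sphere is used. If every leg of \<open>z\<close> looks like a leg of a retained word, the hashes of \<open>z\<close> at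
  the three legs other than \<open>root\<close> are points of the sphere, and the leg \<open>root\<close> forces their sum to be three times
  a fourth point of the sphere. By strict convexity the four points coincide, so \<open>z\<close> is retained as well.
\<close>

lemma hits_if_locally_hits:
  assumes z: "z \<in> patterns"
    and f: "\<And>v. v \<in> S \<Longrightarrow> f v \<in> patterns \<and> same_support v z (f v) \<and> (\<exists>b\<in>sphere \<rho>. hits c s b (f v))"
  shows "\<exists>b\<in>sphere \<rho>. hits c s b z"
proof -
  obtain b where b: "\<And>v. v \<in> S \<Longrightarrow> b v \<in> sphere \<rho>" "\<And>v. v \<in> S \<Longrightarrow> hits c s (b v) (f v)"
    using f by metis
  define R where "R = S - {root}"
  have le: "b v i \<le> m" if "v \<in> S" "i < n" for v i using b(1)[OF that(1)] that(2) by (auto simp: sphere_def PiE_iff)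
  have norm: "(\<Sum>i<n. (real (b v i))\<^sup>2) = real \<rho>" if "v \<in> S" for v
    using b(1)[OF that] unfolding sphere_def by (simp flip: of_nat_power of_nat_sum)
  have hash: "(s v i + weight (c i) v z) mod p = b v i" if "v \<in> R" "i < n" for v i
    using b(2)[of v] weight_cong[of v z "f v"] f that by (auto simp: R_def hits_def)
  have sum: "(\<Sum>v\<in>R. b v i) = 3 * b root i" if i: "i < n" for i
  proof -
    have "[(\<Sum>v\<in>R. b v i) = (\<Sum>v\<in>R. s v i + weight (c i) v z)] (mod p)"
    proof -
      have "(\<Sum>v\<in>R. b v i) = (\<Sum>v\<in>R. (s v i + weight (c i) v z) mod p)" using hash i by simp
      thus ?thesis by (simp add: cong_def mod_sum_eq)
    qed
    hence "[(\<Sum>v\<in>R. b v i) + weight (c i) root z = (\<Sum>v\<in>R. s v i + weight (c i) v z) + weight (c i) root z] (mod p)"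
      by (rule cong_add[OF _ cong_refl])
    also have "(\<Sum>v\<in>R. s v i + weight (c i) v z) + weight (c i) root z = (\<Sum>v\<in>R. s v i) + 2 * (\<Sum>j<N. c i j)"
      using sum_weight_nonroot[OF z, of "c i"] by (simp add: sum.distrib add.assoc R_def)
    also have "[\<dots> = 3 * b root i + weight (c i) root (f root)] (mod p)"
      unfolding R_def using sum_of_hits[OF _ b(2) i, of root] f root by (auto intro: cong_sym)
    finally have "[(\<Sum>v\<in>R. b v i) = 3 * b root i] (mod p)"
      using f[OF root] weight_cong[of root z "f root"] by (simp add: cong_add_rcancel_nat)
    moreover have "(\<Sum>v\<in>R. b v i) \<le> (\<Sum>v\<in>R. m)" using le i by (intro sum_mono) (auto simp: R_def)
    ultimately show ?thesis using p le[OF root i] card_nonroot by (simp add: cong_def R_def)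
  qed
  \<comment> \<open>Expanding \<open>\<Sum>v\<in>R. norm (b v - b root)\<^sup>2\<close> with all norms equal and \<open>\<Sum>v\<in>R. b v = 3 * b root\<close> gives 0.\<close>
  have inner: "(\<Sum>v\<in>R. \<Sum>i<n. real (b v i) * real (b root i)) = 3 * real \<rho>"
  proof -
    have "(\<Sum>v\<in>R. \<Sum>i<n. real (b v i) * real (b root i)) = (\<Sum>i<n. real (\<Sum>v\<in>R. b v i) * real (b root i))"
      by (subst sum.swap) (simp add: sum_distrib_right)
    also have "\<dots> = 3 * (\<Sum>i<n. (real (b root i))\<^sup>2)"
      by (simp add: sum sum_distrib_left power2_eq_square mult_ac del: of_nat_sum)
    finally show ?thesis using norm[OF root] by simp
  qed
  have "(\<Sum>v\<in>R. \<Sum>i<n. (real (b v i) - real (b root i))\<^sup>2) =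
        (\<Sum>v\<in>R. (\<Sum>i<n. (real (b v i))\<^sup>2) + (\<Sum>i<n. (real (b root i))\<^sup>2)
            - 2 * (\<Sum>i<n. real (b v i) * real (b root i)))"
    by (simp add: power2_diff sum.distrib sum_subtractf sum_distrib_left mult_ac)
  also have "\<dots> = (\<Sum>v\<in>R. real \<rho> + real \<rho>) - 2 * (\<Sum>v\<in>R. \<Sum>i<n. real (b v i) * real (b root i))"
    using norm root by (simp add: sum_subtractf sum_distrib_left R_def)
  also have "\<dots> = 0" unfolding inner using card_nonroot by (simp add: R_def)
  finally have "\<forall>v\<in>R. \<forall>i<n. b v i = b root i"
    using finite_S by (simp add: sum_nonneg_eq_0_iff sum_nonneg R_def)
  hence "hits c s (b root) z" using hash by (auto simp: hits_def R_def)
  thus ?thesis using b(1)[OF root] by blast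
qed

lemma target_unique:
  assumes "hits c s b z" "hits c s b' z" "b \<in> sphere \<rho>" "b' \<in> sphere \<rho>"
  shows "b = b'"
proof -
  have "S - {root} \<noteq> {}" using card_nonroot by (intro notI) simp
  then obtain v where v: "v \<in> S - {root}" by blast
  show ?thesis
  proof (rule PiE_ext)
    show "b \<in> {..<n} \<rightarrow>\<^sub>E {..m}" "b' \<in> {..<n} \<rightarrow>\<^sub>E {..m}" using assms by (simp_all add: sphere_def)
    show "b i = b' i" if "i \<in> {..<n}" for i
      using assms(1,2) v that unfolding hits_def by auto
  qed
qed

lemma shift_unique:
  assumes "hits c s b z" "hits c s' b z" "s \<in> shifts" "s' \<in> shifts"
  shows "s = s'"
proof (rule PiE_ext)
  show "s \<in> (S - {root}) \<rightarrow>\<^sub>E ({..<n} \<rightarrow>\<^sub>E {..<p})" "s' \<in> (S - {root}) \<rightarrow>\<^sub>E ({..<n} \<rightarrow>\<^sub>E {..<p})"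
    using assms by (simp_all add: shifts_def)
  fix v assume v: "v \<in> S - {root}"
  have sv: "s v \<in> {..<n} \<rightarrow>\<^sub>E {..<p}" "s' v \<in> {..<n} \<rightarrow>\<^sub>E {..<p}"
    using assms v by (auto simp: shifts_def intro: PiE_mem)
  show "s v = s' v"
  proof (rule PiE_ext[OF sv])
    fix i assume i: "i \<in> {..<n}"
    have "[s v i + weight (c i) v z = s' v i + weight (c i) v z] (mod p)"
      using assms v i by (simp add: hits_def cong_def)
    hence "[s v i = s' v i] (mod p)" by (simp add: cong_add_rcancel_nat)
    moreover have "s v i < p" "s' v i < p" using sv i by (auto simp: PiE_iff)
    ultimately show "s v i = s' v i" by (simp add: cong_def)
  qed
qed

lemma shift_exists:
  assumes "b \<in> sphere \<rho>"
  shows "\<exists>s\<in>shifts. hits c s b z"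
proof -
  define s where "s = (\<lambda>v\<in>S - {root}. \<lambda>i\<in>{..<n}. (b i + (p - weight (c i) v z mod p)) mod p)"
  have "s \<in> shifts" using p_pos by (auto simp: s_def shifts_def)
  moreover have "hits c s b z"
    unfolding hits_def
  proof (intro ballI allI impI)
    fix v i assume v: "v \<in> S - {root}" and i: "i < n"
    have "b i < p" using assms i p by (force simp: sphere_def PiE_iff)
    have "(s v i + weight (c i) v z) mod p = (b i + (p - weight (c i) v z mod p) + weight (c i) v z mod p) mod p"
      using v i by (simp add: s_def mod_simps)
    also have "b i + (p - weight (c i) v z mod p) + weight (c i) v z mod p = b i + p"
      using mod_less_divisor[OF p_pos, of "weight (c i) v z"] by linarith
    finally show "(s v i + weight (c i) v z) mod p = b i" using \<open>b i < p\<close> by simp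
  qed
  ultimately show ?thesis by blast
qed

definition key_rows :: "(nat \<Rightarrow> 'v set) \<Rightarrow> (nat \<Rightarrow> 'v set) \<Rightarrow> (nat \<Rightarrow> nat) set" where
  "key_rows z z' = {x \<in> {..<N} \<rightarrow>\<^sub>E {..<p}. \<forall>v\<in>S. [weight x v z = weight x v z'] (mod p)}"

lemma finite_key_rows: "finite (key_rows z z')"
  by (rule finite_subset[of _ "{..<N} \<rightarrow>\<^sub>E {..<p}"]) (auto simp: key_rows_def intro: finite_PiE)

lemma key_rows_if_common_hits:
  assumes "z \<in> patterns" "z' \<in> patterns" "c \<in> keys" "hits c s b z" "hits c s b z'" "i < n"
  shows "c i \<in> key_rows z z'"
proof -
  have "c i \<in> {..<N} \<rightarrow>\<^sub>E {..<p}" using assms(3,6) PiE_mem[of c "{..<n}"] by (simp add: keys_def)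
  moreover have "[weight (c i) v z = weight (c i) v z'] (mod p)" if "v \<in> S" for v
  proof (cases "v = root")
    case True
    have "[3 * b i + weight (c i) root z = 3 * b i + weight (c i) root z'] (mod p)"
      by (rule cong_trans[OF sum_of_hits[OF assms(1,4,6)] cong_sym[OF sum_of_hits[OF assms(2,5,6)]]])
    thus ?thesis using True by (simp add: cong_add_lcancel_nat)
  next
    case False
    hence "[s v i + weight (c i) v z = s v i + weight (c i) v z'] (mod p)"
      using assms(4-6) that by (simp add: hits_def cong_def)
    thus ?thesis by (simp add: cong_add_lcancel_nat)
  qed
  ultimately show ?thesis by (simp add: key_rows_def)
qed

text \<open>
  The linear equation for leg \<open>v\<close> has coefficients in \<open>{-1, 0, 1}\<close>, and its coefficient at position \<open>j\<close> is a
  unit for every modulus \<open>p\<close>. It therefore determines the entry at \<open>j\<close> from the entries at all other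
  positions with nonzero coefficient.
\<close>

lemma key_row_determined_at:
  assumes x: "x \<in> key_rows z z'" "x' \<in> key_rows z z'" and v: "v \<in> S"
    and j: "j < N" "(v \<in> z j) \<noteq> (v \<in> z' j)"
    and other: "\<And>l. l < N \<Longrightarrow> l \<noteq> j \<Longrightarrow> x l = x' l \<or> (v \<in> z l \<longleftrightarrow> v \<in> z' l)"
  shows "x j = x' j"
proof -
  define d where "d = (\<lambda>l. of_bool (v \<in> z l) - of_bool (v \<in> z' l) :: int)"
  have zero: "[(\<Sum>l<N. int (y l) * d l) = 0] (mod int p)" if "y \<in> key_rows z z'" for y
  proof -
    have "[int (weight y v z) = int (weight y v z')] (mod int p)"
      using that v by (simp add: key_rows_def cong_int_iff)
    hence "[int (weight y v z) - int (weight y v z') = 0] (mod int p)"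
      by (simp add: cong_iff_dvd_diff)
    thus ?thesis by (simp add: weight_def d_def right_diff_distrib sum_subtractf)
  qed
  have "[(\<Sum>l<N. int (x l) * d l) - (\<Sum>l<N. int (x' l) * d l) = 0 - 0] (mod int p)"
    by (intro cong_diff zero x)
  also have "(\<Sum>l<N. int (x l) * d l) - (\<Sum>l<N. int (x' l) * d l) = (\<Sum>l<N. (int (x l) - int (x' l)) * d l)"
    by (simp add: sum_subtractf left_diff_distrib)
  also have "\<dots> = (\<Sum>l<N. if l = j then (int (x j) - int (x' j)) * d j else 0)"
    using other by (intro sum.cong refl) (auto simp: d_def)
  also have "\<dots> = (int (x j) - int (x' j)) * d j" using j(1) by simp
  finally have "int p dvd (int (x j) - int (x' j)) * d j" by (simp add: cong_0_iff)
  moreover have "d j = 1 \<or> d j = - 1" using j(2) by (auto simp: d_def)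
  hence "is_unit (d j)" by auto
  ultimately have "int p dvd int (x j) - int (x' j)" by (simp only: dvd_mult_unit_iff)
  hence "[int (x j) = int (x' j)] (mod int p)" by (simp add: cong_iff_dvd_diff)
  hence "[x j = x' j] (mod p)" by (simp add: cong_int_iff)
  moreover have "x j < p" "x' j < p" using x j(1) by (auto simp: key_rows_def PiE_iff)
  ultimately show ?thesis by (simp add: cong_def)
qed

lemma card_key_rows_le_if_determined:
  assumes J: "J \<subseteq> {..<N}"
    and det: "\<And>x x' j. \<lbrakk>x \<in> key_rows z z'; x' \<in> key_rows z z'; \<And>l. l < N \<Longrightarrow> l \<notin> J \<Longrightarrow> x l = x' l; j \<in> J\<rbrakk>
                \<Longrightarrow> x j = x' j"
  shows "card (key_rows z z') \<le> p ^ (N - card J)"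
proof -
  define T where "T = {..<N} - J"
  have "card (key_rows z z') \<le> card (T \<rightarrow>\<^sub>E {..<p})"
  proof (rule card_inj_on_le)
    show "inj_on (\<lambda>x. restrict x T) (key_rows z z')"
    proof (rule inj_onI)
      fix x x' assume xx: "x \<in> key_rows z z'" "x' \<in> key_rows z z'" "restrict x T = restrict x' T"
      have "x l = x' l" if "l < N" "l \<notin> J" for l
        using fun_cong[OF xx(3), of l] that by (simp add: T_def)
      moreover from this have "x j = x' j" if "j \<in> J" for j using det[OF xx(1,2) _ that] by blast
      ultimately have "x l = x' l" if "l \<in> {..<N}" for l using that by blast
      thus "x = x'" using xx(1,2) by (intro PiE_ext[of x "{..<N}" "\<lambda>_. {..<p}"]) (auto simp: key_rows_def)
    qed
    show "(\<lambda>x. restrict x T) ` key_rows z z' \<subseteq> T \<rightarrow>\<^sub>E {..<p}"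
      by (auto simp: key_rows_def T_def restrict_PiE_iff dest: PiE_mem)
    show "finite (T \<rightarrow>\<^sub>E {..<p})" by (auto simp: T_def intro: finite_PiE)
  qed
  also have "\<dots> = p ^ card T" by (simp add: card_PiE T_def)
  also have "card T = N - card J" using J by (simp add: T_def card_Diff_subset finite_subset)
  finally show ?thesis .
qed

lemma card_key_rows_distinct:
  assumes z: "z \<in> patterns" "z' \<in> patterns" "z \<noteq> z'"
  shows "card (key_rows z z') \<le> p ^ (N - 1)"
proof -
  obtain j where j: "j < N" "z j \<noteq> z' j"
    using z PiE_ext[of z "{..<N}" "\<lambda>_. complete_edges S" z'] by (auto simp: patterns_def)
  then obtain v where v: "v \<in> S" "(v \<in> z j) \<noteq> (v \<in> z' j)"
    using patternsD[OF z(1) j(1)] patternsD[OF z(2) j(1)] by blast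
  have "card (key_rows z z') \<le> p ^ (N - card {j})"
    using j(1) v by (intro card_key_rows_le_if_determined) (auto intro: key_row_determined_at)
  thus ?thesis by simp
qed

text \<open>
  At a position \<open>j\<close> where leg \<open>w\<close> distinguishes the words, only one further leg does, as both pairs
  have two elements and agree on \<open>v\<close>. The remaining leg \<open>a\<close> therefore has coefficient 0 at \<open>j\<close>, but it
  distinguishes the words at some other position \<open>j'\<close>. The equations for \<open>a\<close> and \<open>w\<close> are thus in triangular form
  and determine two entries of the row.
\<close>

lemma card_key_rows_one_shared:
  assumes z: "z \<in> patterns" "z' \<in> patterns" and v: "v \<in> S" "same_support v z z'"
    and only: "\<And>w. w \<in> S \<Longrightarrow> w \<noteq> v \<Longrightarrow> \<not> same_support w z z'"
  shows "card (key_rows z z') \<le> p ^ (N - 2)"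
proof -
  have "card (S - {v}) = 3" using card_S v finite_S by simp
  hence "S - {v} \<noteq> {}" by (intro notI) simp
  then obtain w where w: "w \<in> S" "v \<noteq> w" by blast
  then obtain j where j: "j < N" "(w \<in> z j) \<noteq> (w \<in> z' j)" using only[of w] by (auto simp: same_support_def)
  obtain c d where S: "S = {v, w, c, d}" and dist: "distinct [v, w, c, d]"
    by (rule four_set_with_pair[OF card_S v(1) w])
  have "\<exists>a\<in>{c, d}. a \<in> z j \<longleftrightarrow> a \<in> z' j"
  proof -
    have "z j \<in> complete_edges S" "z' j \<in> complete_edges S"
      using z j(1) PiE_mem[of _ "{..<N}"] by (auto simp: patterns_def)
    hence "z j \<in> complete_edges {v, w, c, d}" "z' j \<in> complete_edges {v, w, c, d}"
      unfolding S by simp_all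
    moreover have "v \<in> z j \<longleftrightarrow> v \<in> z' j" using v j(1) by (simp add: same_support_def)
    ultimately show ?thesis
      using dist j(2) unfolding complete_edges_four[OF dist] by auto
  qed
  then obtain a where a: "a \<in> S" "a \<noteq> v" "a \<in> z j \<longleftrightarrow> a \<in> z' j" using S dist by auto
  obtain j' where j': "j' < N" "(a \<in> z j') \<noteq> (a \<in> z' j')" using only[OF a(1,2)] by (auto simp: same_support_def)
  have "j \<noteq> j'" using a(3) j'(2) by blast
  have "card (key_rows z z') \<le> p ^ (N - card {j, j'})"
  proof (rule card_key_rows_le_if_determined)
    show "{j, j'} \<subseteq> {..<N}" using j j' by simp
    fix x x' i
    assume x: "x \<in> key_rows z z'" "x' \<in> key_rows z z'" and eq: "\<And>l. l < N \<Longrightarrow> l \<notin> {j, j'} \<Longrightarrow> x l = x' l"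
      and i: "i \<in> {j, j'}"
    have 1: "x j' = x' j'"
      using eq a(3) by (intro key_row_determined_at[OF x a(1) j']) auto
    have "x j = x' j"
      using eq 1 by (intro key_row_determined_at[OF x w(1) j]) auto
    with 1 show "x i = x' i" using i by blast
  qed
  thus ?thesis using \<open>j \<noteq> j'\<close> by (simp add: numeral_2_eq_2)
qed

definition uniform :: "nat \<Rightarrow> (nat \<Rightarrow> 'v set) set" where
  "uniform k = {z \<in> patterns. \<forall>e\<in>complete_edges S. card {j. j < N \<and> z j = e} = k}"

lemma card_sharing_one:
  assumes "v \<in> S"
  shows "card {z' \<in> patterns. same_support v z z'} = 3 ^ N"
proof -
  have "{z' \<in> patterns. same_support v z z'} = (\<Pi>\<^sub>E j\<in>{..<N}. {e \<in> complete_edges S. v \<in> e \<longleftrightarrow> v \<in> z j})"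
    by (intro set_eqI) (simp add: patterns_def same_support_def PiE_iff, blast)
  thus ?thesis using card_S assms by (simp add: card_PiE card_pairs_matching_one)
qed

lemma card_sharing_two:
  assumes z: "z \<in> uniform k" and vw: "v \<in> S" "w \<in> S" "v \<noteq> w"
  shows "card {z' \<in> patterns. same_support v z z' \<and> same_support w z z'} = 2 ^ (4 * k)"
proof -
  have "{z' \<in> patterns. same_support v z z' \<and> same_support w z z'} =
        (\<Pi>\<^sub>E j\<in>{..<N}. {e \<in> complete_edges S. (v \<in> e \<longleftrightarrow> v \<in> z j) \<and> (w \<in> e \<longleftrightarrow> w \<in> z j)})"
    by (intro set_eqI) (simp add: patterns_def same_support_def PiE_iff, blast)
  hence "card {z' \<in> patterns. same_support v z z' \<and> same_support w z z'} =
        (\<Prod>j<N. if (v \<in> z j) = (w \<in> z j) then 1 else 2)"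
    by (simp add: card_PiE card_pairs_matching_two(1)[OF card_S vw])
  also have "\<dots> = (\<Prod>j\<in>{j. j < N \<and> (v \<in> z j) \<noteq> (w \<in> z j)}. 2)"
    by (intro prod.mono_neutral_cong_right) auto
  also have "\<dots> = 2 ^ card {j. j < N \<and> (v \<in> z j) \<noteq> (w \<in> z j)}" by simp
  also have "{j. j < N \<and> (v \<in> z j) \<noteq> (w \<in> z j)} =
      (\<Union>e\<in>{e \<in> complete_edges S. (v \<in> e) \<noteq> (w \<in> e)}. {j. j < N \<and> z j = e})"
    using z by (auto simp: uniform_def patterns_def PiE_iff)
  also have "card \<dots> = (\<Sum>e\<in>{e \<in> complete_edges S. (v \<in> e) \<noteq> (w \<in> e)}. card {j. j < N \<and> z j = e})"
    using finite_complete_edges[OF finite_S] by (intro card_UN_disjoint) auto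
  also have "\<dots> = (\<Sum>e\<in>{e \<in> complete_edges S. (v \<in> e) \<noteq> (w \<in> e)}. k)"
    using z by (intro sum.cong refl) (auto simp: uniform_def)
  also have "\<dots> = 4 * k" using card_pairs_matching_two(2)[OF card_S vw] by simp
  finally show ?thesis .
qed

definition conflicts :: "(nat \<Rightarrow> 'v set) \<Rightarrow> (nat \<Rightarrow> 'v set) set" where
  "conflicts z = {z' \<in> patterns. z' \<noteq> z \<and> (\<exists>v\<in>S. same_support v z z')}"

text \<open>
  The first summand counts the words that share at least one leg with \<open>z\<close>, the second those that share two or
  more. The latter are easier to confuse with \<open>z\<close>, since only one entry per row of the key is determined, but
  there are far fewer of them.
\<close>

lemma sum_conflicts_le:
  assumes z: "z \<in> uniform k"
  shows "(\<Sum>z'\<in>conflicts z. card (key_rows z z') ^ n) \<le>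
           4 * 3 ^ N * p ^ ((N - 2) * n) + 6 * 2 ^ (4 * k) * p ^ ((N - 1) * n)"
proof -
  have zp: "z \<in> patterns" using z by (simp add: uniform_def)
  define A where "A = (\<lambda>v. {z' \<in> patterns. same_support v z z'})"
  define D where "D = (\<Union>e\<in>complete_edges S. \<Inter>v\<in>e. A v)"
  have finA: "finite (A v)" for v using finite_patterns by (simp add: A_def)
  have pair: "card (\<Inter>v\<in>e. A v) = 2 ^ (4 * k) \<and> finite (\<Inter>v\<in>e. A v)" if edge: "e \<in> complete_edges S" for e
  proof -
    obtain v w where e': "e = {v, w}" "v \<noteq> w"
      using edge unfolding complete_edges_def card_2_iff by blast
    hence e: "e = {v, w}" "v \<noteq> w" "v \<in> S" "w \<in> S" using edge by (simp_all add: complete_edges_def)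
    have "(\<Inter>v\<in>e. A v) = {z' \<in> patterns. same_support v z z' \<and> same_support w z z'}"
      using e by (auto simp: A_def)
    thus ?thesis using card_sharing_two[OF z e(3,4,2)] finite_patterns by simp
  qed
  have "card D \<le> (\<Sum>e\<in>complete_edges S. card (\<Inter>v\<in>e. A v))"
    unfolding D_def by (intro card_UN_le finite_complete_edges finite_S)
  also have "\<dots> = 6 * 2 ^ (4 * k)"
    using pair card_complete_edges[OF finite_S] card_S by (simp add: choose_two)
  finally have cD: "card D \<le> 6 * 2 ^ (4 * k)" .
  have finD: "finite D"
    unfolding D_def using pair finite_complete_edges[OF finite_S] by auto
  have cA: "card (\<Union>v\<in>S. A v) \<le> 4 * 3 ^ N"
    using card_UN_le[OF finite_S, of A] card_S by (simp add: A_def card_sharing_one)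
  have fin: "finite (conflicts z)" using finite_patterns by (simp add: conflicts_def)
  have "(\<Sum>z'\<in>conflicts z. card (key_rows z z') ^ n) \<le>
        (\<Sum>z'\<in>conflicts z. p ^ ((N - 2) * n) + (if z' \<in> D then p ^ ((N - 1) * n) else 0))"
  proof (rule sum_mono)
    fix z' assume z': "z' \<in> conflicts z"
    hence zp': "z' \<in> patterns" "z \<noteq> z'" by (auto simp: conflicts_def)
    show "card (key_rows z z') ^ n \<le> p ^ ((N - 2) * n) + (if z' \<in> D then p ^ ((N - 1) * n) else 0)"
    proof (cases "z' \<in> D")
      case True
      have "card (key_rows z z') ^ n \<le> (p ^ (N - 1)) ^ n"
        by (intro power_mono card_key_rows_distinct zp zp') simp
      thus ?thesis using True by (simp add: power_mult)
    next
      case False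
      obtain v where v: "v \<in> S" "same_support v z z'" using z' by (auto simp: conflicts_def)
      have "\<not> same_support w z z'" if w: "w \<in> S" "w \<noteq> v" for w
      proof
        assume "same_support w z z'"
        hence "z' \<in> (\<Inter>u\<in>{v, w}. A u)" using v zp' by (simp add: A_def)
        moreover have "{v, w} \<in> complete_edges S" using v w by (simp add: complete_edges_def)
        ultimately show False using False unfolding D_def by blast
      qed
      hence "card (key_rows z z') ^ n \<le> (p ^ (N - 2)) ^ n"
        by (intro power_mono card_key_rows_one_shared[OF zp zp'(1) v]) simp_all
      thus ?thesis using False by (simp add: power_mult)
    qed
  qed
  also have "\<dots> = card (conflicts z) * p ^ ((N - 2) * n) + card (conflicts z \<inter> D) * p ^ ((N - 1) * n)"
    using fin by (simp add: sum.distrib sum.inter_restrict [symmetric])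
  also have "\<dots> \<le> (4 * 3 ^ N) * p ^ ((N - 2) * n) + (6 * 2 ^ (4 * k)) * p ^ ((N - 1) * n)"
  proof (intro add_mono mult_right_mono)
    have "card (conflicts z) \<le> card (\<Union>v\<in>S. A v)"
      using finA finite_S by (intro card_mono) (auto simp: conflicts_def A_def)
    thus "card (conflicts z) \<le> 4 * 3 ^ N" using cA by simp
    have "card (conflicts z \<inter> D) \<le> card D" using finD by (intro card_mono) auto
    thus "card (conflicts z \<inter> D) \<le> 6 * 2 ^ (4 * k)" using cD by simp
  qed simp_all
  finally show ?thesis by simp
qed

definition survives :: "(nat \<Rightarrow> nat \<Rightarrow> nat) \<times> ('v \<Rightarrow> nat \<Rightarrow> nat) \<Rightarrow> nat \<Rightarrow> (nat \<Rightarrow> 'v set) \<Rightarrow> bool" where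
  "survives \<omega> \<rho> z \<longleftrightarrow> (\<exists>b\<in>sphere \<rho>. hits (fst \<omega>) (snd \<omega>) b z)"

lemma finite_sphere: "finite (sphere \<rho>)"
  by (rule finite_subset[of _ "{..<n} \<rightarrow>\<^sub>E {..m}"]) (auto simp: sphere_def intro: finite_PiE)

lemma finite_keys: "finite keys"
  unfolding keys_def by (intro finite_PiE) auto

lemma card_keys: "card keys = p ^ (N * n)"
  by (simp add: keys_def card_PiE power_mult)

lemma finite_shifts: "finite shifts"
  unfolding shifts_def using finite_S by (intro finite_PiE) auto

lemma card_shifts: "card shifts = p ^ (3 * n)"
  using finite_S card_nonroot by (simp add: shifts_def card_PiE power_mult [symmetric] mult.commute)

text \<open>
  For a given word, key and target there is a shift that hits the target.
\<close>

lemma card_surviving_parameters: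
  "card (sphere \<rho>) * card keys \<le> card {\<omega> \<in> keys \<times> shifts. survives \<omega> \<rho> z}"
proof -
  define \<sigma> where "\<sigma> = (\<lambda>b c. SOME s. s \<in> shifts \<and> hits c s b z)"
  have \<sigma>: "\<sigma> b c \<in> shifts \<and> hits c (\<sigma> b c) b z" if "b \<in> sphere \<rho>" for b c
  proof -
    have "\<exists>s. s \<in> shifts \<and> hits c s b z" using shift_exists[OF that] by blast
    from someI_ex[OF this] show ?thesis by (simp only: \<sigma>_def)
  qed
  have "card (sphere \<rho> \<times> keys) \<le> card {\<omega> \<in> keys \<times> shifts. survives \<omega> \<rho> z}"
  proof (rule card_inj_on_le)
    show "inj_on (\<lambda>(b, c). (c, \<sigma> b c)) (sphere \<rho> \<times> keys)"
    proof (rule inj_onI)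
      fix y y' assume y: "y \<in> sphere \<rho> \<times> keys" "y' \<in> sphere \<rho> \<times> keys"
        "(case y of (b, c) \<Rightarrow> (c, \<sigma> b c)) = (case y' of (b, c) \<Rightarrow> (c, \<sigma> b c))"
      obtain b c b' where yy: "y = (b, c)" "y' = (b', c)" using y(3) by (cases y, cases y') auto
      have b: "b \<in> sphere \<rho>" "b' \<in> sphere \<rho>" "\<sigma> b c = \<sigma> b' c" using y by (auto simp: yy)
      have "hits c (\<sigma> b c) b z" "hits c (\<sigma> b c) b' z"
        using \<sigma>[OF b(1), of c] \<sigma>[OF b(2), of c] b(3) by simp_all
      thus "y = y'" unfolding yy using target_unique[OF _ _ b(1,2)] by blast
    qed
    show "(\<lambda>(b, c). (c, \<sigma> b c)) ` (sphere \<rho> \<times> keys) \<subseteq> {\<omega> \<in> keys \<times> shifts. survives \<omega> \<rho> z}"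
      using \<sigma> by (fastforce simp: survives_def)
    show "finite {\<omega> \<in> keys \<times> shifts. survives \<omega> \<rho> z}" using finite_keys finite_shifts by simp
  qed
  thus ?thesis by (simp add: card_cartesian_product)
qed

text \<open>
  Two retained words with a common leg have the same target, by comparison of the hashes at that leg. The key
  must then hash both words equally, and key and target determine the shift.
\<close>

lemma card_jointly_surviving_parameters:
  assumes z: "z \<in> patterns" "z' \<in> conflicts z"
  shows "card {\<omega> \<in> keys \<times> shifts. survives \<omega> \<rho> z \<and> survives \<omega> \<rho> z'} \<le>
           card (sphere \<rho>) * card (key_rows z z') ^ n"
proof -
  have z': "z' \<in> patterns" using z(2) by (simp add: conflicts_def)
  obtain v where v: "v \<in> S" "same_support v z z'" using z(2) by (auto simp: conflicts_def)
  define W where "W = {\<omega> \<in> keys \<times> shifts. survives \<omega> \<rho> z \<and> survives \<omega> \<rho> z'}"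
  have "\<exists>b\<in>sphere \<rho>. hits (fst \<omega>) (snd \<omega>) b z \<and> hits (fst \<omega>) (snd \<omega>) b z'" if "\<omega> \<in> W" for \<omega>
    using that equal_targets_if_shared_leg[OF z(1) z' _ _ _ _ v] unfolding W_def survives_def by blast
  then obtain \<beta> where \<beta>: "\<And>\<omega>. \<omega> \<in> W \<Longrightarrow> \<beta> \<omega> \<in> sphere \<rho>"
    "\<And>\<omega>. \<omega> \<in> W \<Longrightarrow> hits (fst \<omega>) (snd \<omega>) (\<beta> \<omega>) z" "\<And>\<omega>. \<omega> \<in> W \<Longrightarrow> hits (fst \<omega>) (snd \<omega>) (\<beta> \<omega>) z'"
    by metis
  have "card W \<le> card (sphere \<rho> \<times> ({..<n} \<rightarrow>\<^sub>E key_rows z z'))"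
  proof (rule card_inj_on_le)
    show "inj_on (\<lambda>\<omega>. (\<beta> \<omega>, fst \<omega>)) W"
    proof (rule inj_onI)
      fix \<omega> \<omega>' assume w: "\<omega> \<in> W" "\<omega>' \<in> W" "(\<beta> \<omega>, fst \<omega>) = (\<beta> \<omega>', fst \<omega>')"
      have "snd \<omega> = snd \<omega>'"
      proof (rule shift_unique)
        show "hits (fst \<omega>) (snd \<omega>) (\<beta> \<omega>) z" by (rule \<beta>(2)[OF w(1)])
        show "hits (fst \<omega>) (snd \<omega>') (\<beta> \<omega>) z" using \<beta>(2)[OF w(2)] w(3) by simp
        show "snd \<omega> \<in> shifts" "snd \<omega>' \<in> shifts" using w by (auto simp: W_def)
      qed
      thus "\<omega> = \<omega>'" using w(3) by (simp add: prod_eq_iff)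
    qed
    show "(\<lambda>\<omega>. (\<beta> \<omega>, fst \<omega>)) ` W \<subseteq> sphere \<rho> \<times> ({..<n} \<rightarrow>\<^sub>E key_rows z z')"
    proof (rule image_subsetI)
      fix \<omega> assume w: "\<omega> \<in> W"
      have c: "fst \<omega> \<in> keys" using w by (auto simp: W_def)
      have "fst \<omega> i \<in> key_rows z z'" if "i < n" for i
        by (rule key_rows_if_common_hits[OF z(1) z' c \<beta>(2)[OF w] \<beta>(3)[OF w] that])
      moreover have "fst \<omega> \<in> extensional {..<n}" using c by (simp add: keys_def PiE_def)
      ultimately have "fst \<omega> \<in> {..<n} \<rightarrow>\<^sub>E key_rows z z'" by (simp add: PiE_iff)
      thus "(\<beta> \<omega>, fst \<omega>) \<in> sphere \<rho> \<times> ({..<n} \<rightarrow>\<^sub>E key_rows z z')" using \<beta>(1)[OF w] by simp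
    qed
    show "finite (sphere \<rho> \<times> ({..<n} \<rightarrow>\<^sub>E key_rows z z'))"
      by (intro finite_cartesian_product finite_sphere finite_PiE finite_lessThan finite_key_rows)
  qed
  thus ?thesis by (simp add: W_def card_cartesian_product card_PiE)
qed

lemma finite_uniform: "finite (uniform k)"
  using finite_patterns by (simp add: uniform_def)

text \<open>
  Choose parameters at random, retain the surviving words of \<open>uniform k\<close>, and discard those that share a leg with any
  other surviving word, balanced or not. The remaining family has the required property by
  \<open>hits_if_locally_hits\<close>. The inequality compares its expected size with the expected number of surviving
  words and of conflicts.
\<close>

lemma free_family_exists:
  assumes N: "2 \<le> N"
  shows "\<exists>\<Lambda> \<subseteq> uniform k.
     (\<forall>z\<in>patterns. \<forall>f. (\<forall>v\<in>S. f v \<in> \<Lambda> \<and> same_support v z (f v)) \<longrightarrow> (\<forall>v\<in>S. f v = z)) \<and>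
     real (card (uniform k)) * real (card (sphere \<rho>))
       * (1 - 4 * 3 ^ N / real p ^ (2 * n) - 6 * 2 ^ (4 * k) / real p ^ n) \<le> real p ^ (3 * n) * real (card \<Lambda>)"
proof -
  define U where "U = uniform k"
  define \<Omega> where "\<Omega> = keys \<times> shifts"
  define \<Lambda> where "\<Lambda> = (\<lambda>\<omega>. {z \<in> U. survives \<omega> \<rho> z \<and> \<not> (\<exists>z'\<in>conflicts z. survives \<omega> \<rho> z')})"
  have fin: "finite U" "finite \<Omega>" "\<And>z. finite (conflicts z)"
    using finite_uniform finite_keys finite_shifts finite_patterns by (simp_all add: U_def \<Omega>_def conflicts_def)
  have UP: "z \<in> patterns" if "z \<in> U" for z using that by (simp add: U_def uniform_def)
  have free: "\<forall>z\<in>patterns. \<forall>f. (\<forall>v\<in>S. f v \<in> \<Lambda> \<omega> \<and> same_support v z (f v)) \<longrightarrow> (\<forall>v\<in>S. f v = z)" for \<omega>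
  proof (intro ballI allI impI)
    fix z f v assume z: "z \<in> patterns" and f: "\<forall>v\<in>S. f v \<in> \<Lambda> \<omega> \<and> same_support v z (f v)" and v: "v \<in> S"
    have "survives \<omega> \<rho> z"
      unfolding survives_def using z by (rule hits_if_locally_hits[of z f])
        (use f UP in \<open>auto simp: \<Lambda>_def survives_def\<close>)
    moreover have "\<not> (\<exists>z'\<in>conflicts (f v). survives \<omega> \<rho> z')" using f v by (simp add: \<Lambda>_def)
    ultimately have "z \<notin> conflicts (f v)" by blast
    moreover have "same_support v (f v) z" using f v by (simp add: same_support_def)
    ultimately show "f v = z" using z v by (auto simp: conflicts_def)
  qed
  have "card U * (card (sphere \<rho>) * card keys) \<le> (\<Sum>z\<in>U. card {\<omega> \<in> \<Omega>. survives \<omega> \<rho> z})"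
    using card_surviving_parameters sum_mono[of U "\<lambda>_. card (sphere \<rho>) * card keys"] by (simp add: \<Omega>_def)
  also have "\<dots> = (\<Sum>z\<in>U. \<Sum>\<omega>\<in>\<Omega>. of_bool (survives \<omega> \<rho> z))"
    using fin by (simp add: Int_def)
  also have "\<dots> \<le> (\<Sum>z\<in>U. \<Sum>\<omega>\<in>\<Omega>. of_bool (z \<in> \<Lambda> \<omega>) +
                     (\<Sum>z'\<in>conflicts z. of_bool (survives \<omega> \<rho> z \<and> survives \<omega> \<rho> z')))"
  proof (intro sum_mono)
    fix z \<omega> assume z: "z \<in> U"
    show "of_bool (survives \<omega> \<rho> z) \<le> of_bool (z \<in> \<Lambda> \<omega>) +
            (\<Sum>z'\<in>conflicts z. of_bool (survives \<omega> \<rho> z \<and> survives \<omega> \<rho> z') :: nat)"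
    proof (cases "survives \<omega> \<rho> z \<and> z \<notin> \<Lambda> \<omega>")
      case True
      then obtain z' where z': "z' \<in> conflicts z" "survives \<omega> \<rho> z'" using z by (auto simp: \<Lambda>_def)
      hence "of_bool (survives \<omega> \<rho> z \<and> survives \<omega> \<rho> z') \<le>
          (\<Sum>z'\<in>conflicts z. of_bool (survives \<omega> \<rho> z \<and> survives \<omega> \<rho> z') :: nat)"
        using fin by (intro member_le_sum) auto
      thus ?thesis using True z' by simp
    qed auto
  qed
  also have "\<dots> = (\<Sum>\<omega>\<in>\<Omega>. card (\<Lambda> \<omega>)) +
      (\<Sum>z\<in>U. \<Sum>z'\<in>conflicts z. card {\<omega> \<in> \<Omega>. survives \<omega> \<rho> z \<and> survives \<omega> \<rho> z'})"
  proof -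
    have "(\<Sum>z\<in>U. \<Sum>\<omega>\<in>\<Omega>. of_bool (z \<in> \<Lambda> \<omega>)) = (\<Sum>\<omega>\<in>\<Omega>. card (\<Lambda> \<omega>))"
    proof -
      have "(\<Sum>z\<in>U. of_bool (z \<in> \<Lambda> \<omega>)) = card (\<Lambda> \<omega>)" for \<omega>
        using fin by (simp add: \<Lambda>_def Int_def cong: conj_cong)
      thus ?thesis by (subst sum.swap) simp
    qed
    moreover have "(\<Sum>\<omega>\<in>\<Omega>. \<Sum>z'\<in>conflicts z. of_bool (survives \<omega> \<rho> z \<and> survives \<omega> \<rho> z')) =
        (\<Sum>z'\<in>conflicts z. card {\<omega> \<in> \<Omega>. survives \<omega> \<rho> z \<and> survives \<omega> \<rho> z'})" for z
      using fin by (subst sum.swap) (simp add: Int_def)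
    ultimately show ?thesis by (simp only: sum.distrib)
  qed
  also have "\<dots> \<le> (\<Sum>\<omega>\<in>\<Omega>. card (\<Lambda> \<omega>)) +
      (\<Sum>z\<in>U. card (sphere \<rho>) * (4 * 3 ^ N * p ^ ((N - 2) * n) + 6 * 2 ^ (4 * k) * p ^ ((N - 1) * n)))"
  proof (intro add_left_mono sum_mono)
    fix z assume z: "z \<in> U"
    have "(\<Sum>z'\<in>conflicts z. card {\<omega> \<in> \<Omega>. survives \<omega> \<rho> z \<and> survives \<omega> \<rho> z'}) \<le>
          (\<Sum>z'\<in>conflicts z. card (sphere \<rho>) * card (key_rows z z') ^ n)"
      unfolding \<Omega>_def by (intro sum_mono card_jointly_surviving_parameters UP z)
    also have "\<dots> \<le> card (sphere \<rho>) * (4 * 3 ^ N * p ^ ((N - 2) * n) + 6 * 2 ^ (4 * k) * p ^ ((N - 1) * n))"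
      unfolding sum_distrib_left [symmetric] using z sum_conflicts_le[of z k]
      by (intro mult_left_mono) (simp_all add: U_def)
    finally show "(\<Sum>z'\<in>conflicts z. card {\<omega> \<in> \<Omega>. survives \<omega> \<rho> z \<and> survives \<omega> \<rho> z'}) \<le>
        card (sphere \<rho>) * (4 * 3 ^ N * p ^ ((N - 2) * n) + 6 * 2 ^ (4 * k) * p ^ ((N - 1) * n))" .
  qed
  finally have "real (card U * (card (sphere \<rho>) * card keys)) \<le> real ((\<Sum>\<omega>\<in>\<Omega>. card (\<Lambda> \<omega>)) +
      card U * (card (sphere \<rho>) * (4 * 3 ^ N * p ^ ((N - 2) * n) + 6 * 2 ^ (4 * k) * p ^ ((N - 1) * n))))"
    by (simp only: of_nat_le_iff sum_constant of_nat_id)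
  moreover have "real p ^ ((N - 2) * n) = real p ^ (N * n) / real p ^ (2 * n)"
    "real p ^ ((N - 1) * n) = real p ^ (N * n) / real p ^ n"
    using N p_pos by (simp_all add: diff_mult_distrib power_diff)
  ultimately have le: "real (card U) * real (card (sphere \<rho>)) * real p ^ (N * n)
      * (1 - 4 * 3 ^ N / real p ^ (2 * n) - 6 * 2 ^ (4 * k) / real p ^ n) \<le> (\<Sum>\<omega>\<in>\<Omega>. real (card (\<Lambda> \<omega>)))"
    by (simp add: card_keys algebra_simps)
  have "\<exists>\<omega>\<in>\<Omega>. (\<Sum>\<omega>\<in>\<Omega>. real (card (\<Lambda> \<omega>))) \<le> real (card \<Omega>) * real (card (\<Lambda> \<omega>))"
  proof (rule ex_ge_average[OF fin(2)])
    show "\<Omega> \<noteq> {}" using p_pos by (auto simp: \<Omega>_def keys_def shifts_def PiE_eq_empty_iff)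
  qed
  then obtain \<omega> where "(\<Sum>\<omega>\<in>\<Omega>. real (card (\<Lambda> \<omega>))) \<le> real (card \<Omega>) * real (card (\<Lambda> \<omega>))" by blast
  with le have "real (card U) * real (card (sphere \<rho>)) * real p ^ (N * n)
      * (1 - 4 * 3 ^ N / real p ^ (2 * n) - 6 * 2 ^ (4 * k) / real p ^ n) \<le> real (card \<Omega>) * real (card (\<Lambda> \<omega>))"
    by (rule order_trans)
  also have "real (card \<Omega>) = real p ^ (N * n) * real p ^ (3 * n)"
    by (simp add: \<Omega>_def card_cartesian_product card_keys card_shifts)
  finally have "real p ^ (N * n) * (real (card U) * real (card (sphere \<rho>))
      * (1 - 4 * 3 ^ N / real p ^ (2 * n) - 6 * 2 ^ (4 * k) / real p ^ n)) \<le>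
      real p ^ (N * n) * (real p ^ (3 * n) * real (card (\<Lambda> \<omega>)))"
    by (simp add: mult_ac)
  hence "real (card U) * real (card (sphere \<rho>))
      * (1 - 4 * 3 ^ N / real p ^ (2 * n) - 6 * 2 ^ (4 * k) / real p ^ n) \<le> real p ^ (3 * n) * real (card (\<Lambda> \<omega>))"
    using p_pos by (subst (asm) mult_le_cancel_left_pos) auto
  moreover have "\<Lambda> \<omega> \<subseteq> uniform k" by (auto simp: \<Lambda>_def U_def)
  ultimately show ?thesis using free[of \<omega>] unfolding U_def by blast
qed

end

section \<open>Large families of balanced words without mixed combinations\<close>

lemma power_swap: "((x :: 'a :: comm_monoid_mult) ^ a) ^ b = (x ^ b) ^ a"
  by (simp add: power_mult [symmetric] mult.commute)

definition balanced_words :: "nat \<Rightarrow> nat \<Rightarrow> 'a set \<Rightarrow> (nat \<Rightarrow> 'a) set" where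
  "balanced_words N k P = {z \<in> {..<N} \<rightarrow>\<^sub>E P. \<forall>e\<in>P. card {j. j < N \<and> z j = e} = k}"

text \<open>
  The blocks of \<open>\<Lambda>\<close> form a direct sum: a word whose support at every leg \<open>v\<close> is that of some word
  \<open>f v\<close> of \<open>\<Lambda>\<close> exists only if all the \<open>f v\<close> are this word.
\<close>

definition leg_free :: "'v set \<Rightarrow> nat \<Rightarrow> (nat \<Rightarrow> 'v set) set \<Rightarrow> bool" where
  "leg_free S N \<Lambda> \<longleftrightarrow> (\<forall>z\<in>{..<N} \<rightarrow>\<^sub>E complete_edges S. \<forall>f.
     (\<forall>v\<in>S. f v \<in> \<Lambda> \<and> (\<forall>j<N. v \<in> z j \<longleftrightarrow> v \<in> f v j)) \<longrightarrow> (\<forall>v\<in>S. f v = z))"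

lemma fact_power_le_card_balanced_words:
  fixes P :: "'a set"
  assumes P: "finite P" and N: "N = card P * k" and k: "k > 0"
  shows "fact N \<le> card (balanced_words N k P) * fact k ^ card P"
proof -
  define A where "A = (\<Sum>e\<in>P. replicate_mset k e)"
  define W where "W = balanced_words N k P"
  have count: "count A e = (if e \<in> P then k else 0)" for e
    using P by (simp add: A_def count_sum)
  have set: "set_mset A = P" using k by (auto simp: set_mset_def count)
  have size: "size A = N" using P N by (simp add: A_def)
  have "fact N = card (permutations_of_multiset A) * (\<Prod>x\<in>P. fact (count A x))"
    using card_permutations_of_multiset_aux[of A] by (simp add: set size)
  also have "(\<Prod>x\<in>P. fact (count A x)) = (fact k ^ card P :: nat)" by (simp add: count)
  also have "card (permutations_of_multiset A) \<le> card W"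
  proof (rule card_inj_on_le)
    have len: "length xs = N" if "xs \<in> permutations_of_multiset A" for xs
      using that size by (metis permutations_of_multisetD size_mset)
    show "inj_on (\<lambda>xs. \<lambda>j\<in>{..<N}. xs ! j) (permutations_of_multiset A)"
    proof (rule inj_onI)
      fix xs ys assume xs: "xs \<in> permutations_of_multiset A" "ys \<in> permutations_of_multiset A"
        and eq: "(\<lambda>j\<in>{..<N}. xs ! j) = (\<lambda>j\<in>{..<N}. ys ! j)"
      have "xs ! j = ys ! j" if "j < N" for j using fun_cong[OF eq, of j] that by simp
      thus "xs = ys" using len xs by (intro nth_equalityI) auto
    qed
    show "(\<lambda>xs. \<lambda>j\<in>{..<N}. xs ! j) ` permutations_of_multiset A \<subseteq> W"
    proof (rule image_subsetI)
      fix xs assume xs: "xs \<in> permutations_of_multiset A"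
      hence mset: "mset xs = A" by (rule permutations_of_multisetD)
      have "set xs = P" using mset set by (metis set_mset_mset)
      moreover have "card {j. j < N \<and> (\<lambda>j\<in>{..<N}. xs ! j) j = e} = k" if "e \<in> P" for e
      proof -
        have "{j. j < N \<and> (\<lambda>j\<in>{..<N}. xs ! j) j = e} = {j. j < length xs \<and> e = xs ! j}"
          using len[OF xs] by auto
        also have "card \<dots> = count (mset xs) e"
          by (simp add: count_mset length_filter_conv_card count_list_eq_length_filter)
        finally show ?thesis using that by (simp add: mset count)
      qed
      ultimately show "(\<lambda>j\<in>{..<N}. xs ! j) \<in> W" using len[OF xs] by (auto simp: W_def balanced_words_def)
    qed
    show "finite W" using P by (simp add: W_def balanced_words_def finite_PiE)
  qed
  finally show ?thesis by (simp add: W_def)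
qed

text \<open>
  Up to a polynomial factor, \<open>fact (6 * k) / fact k ^ 6\<close> is \<open>(6 ^ 6) ^ k\<close>: increasing \<open>k\<close> multiplies the quotient by
  \<open>\<Prod>i=1..6. (6 * k + i) / (k + 1)\<close>, which is at least \<open>6 ^ 6 * (k / (k + 1)) ^ 5\<close>. The factor 65 covers the
  base case \<open>6 ^ 6 \<le> 65 * 6!\<close>.
\<close>

lemma power_le_fact_6_times:
  assumes "k > 0"
  shows "46656 ^ k * fact k ^ 6 \<le> 65 * k ^ 5 * (fact (6 * k) :: nat)"
  using assms
proof (induction k rule: nat_induct_non_zero)
  case 1
  show ?case by (simp add: fact_numeral)
next
  case (Suc k)
  have "46656 * k ^ 5 * (k + 1) = 6 * k * (6 * k) * (6 * k) * (6 * k) * (6 * k) * (6 * k + 6)"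
  proof -
    have "k ^ 5 = k * k * k * k * k" by (simp add: eval_nat_numeral)
    thus ?thesis by (simp add: algebra_simps)
  qed
  also have "\<dots> \<le> (6 * k + 1) * (6 * k + 2) * (6 * k + 3) * (6 * k + 4) * (6 * k + 5) * (6 * k + 6)"
    by (intro mult_le_mono) simp_all
  finally have step: "46656 * k ^ 5 * (k + 1) \<le> (6 * k + 1) * (6 * k + 2) * (6 * k + 3) * (6 * k + 4) * (6 * k + 5) * (6 * k + 6)" .
  have "46656 ^ Suc k * fact (Suc k) ^ 6 = 46656 * (k + 1) ^ 6 * (46656 ^ k * fact k ^ 6)"
  proof -
    have "fact (Suc k) = (k + 1) * (fact k :: nat)" by simp
    thus ?thesis by (simp only: power_mult_distrib power_Suc mult_ac)
  qed
  also have "\<dots> \<le> 46656 * (k + 1) ^ 6 * (65 * k ^ 5 * fact (6 * k))"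
    by (intro mult_left_mono Suc.IH) simp
  also have "\<dots> = 65 * (k + 1) ^ 5 * fact (6 * k) * (46656 * k ^ 5 * (k + 1))"
  proof -
    have "(k + 1) ^ 6 = (k + 1) ^ 5 * (k + 1)" using power_Suc2[of "k + 1" 5] by simp
    thus ?thesis by (simp only: mult_ac)
  qed
  also have "\<dots> \<le> 65 * (k + 1) ^ 5 * fact (6 * k) * ((6 * k + 1) * (6 * k + 2) * (6 * k + 3) * (6 * k + 4) * (6 * k + 5) * (6 * k + 6))"
    by (intro mult_left_mono step) simp
  also have "\<dots> = 65 * Suc k ^ 5 * fact (6 * Suc k)"
  proof -
    have "fact (m + 6) = fact m * ((m + 1) * (m + 2) * (m + 3) * (m + 4) * (m + 5) * (m + 6) :: nat)" for m
      by (simp add: eval_nat_numeral mult_ac del: mult_Suc mult_Suc_right)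
    moreover have "6 * Suc k = 6 * k + 6" by simp
    ultimately have "fact (6 * Suc k) = fact (6 * k) * ((6 * k + 1) * (6 * k + 2) * (6 * k + 3) * (6 * k + 4) * (6 * k + 5) * (6 * k + 6) :: nat)"
      by (simp only:)
    thus ?thesis by (simp only: mult.assoc Suc_eq_plus1)
  qed
  finally show ?case .
qed

context pair_hashing
begin

text \<open>
  The squared norm takes at most \<open>n * m\<^sup>2 + 1\<close> values on the cube.
\<close>

lemma large_sphere_exists: "\<exists>\<rho>. (m + 1) ^ n \<le> (n * m\<^sup>2 + 1) * card (sphere \<rho>)"
proof -
  define B where "B = {..<n} \<rightarrow>\<^sub>E {..m}"
  have finB: "finite B" unfolding B_def by (intro finite_PiE) auto
  have "(\<Sum>i<n. (b i)\<^sup>2) \<le> n * m\<^sup>2" if "b \<in> B" for b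
  proof -
    have "(\<Sum>i<n. (b i)\<^sup>2) \<le> (\<Sum>i<n. m\<^sup>2)"
      using that by (intro sum_mono power_mono) (auto simp: B_def PiE_iff)
    thus ?thesis by simp
  qed
  hence "card B = (\<Sum>\<rho>\<le>n * m\<^sup>2. card {b \<in> B. (\<Sum>i<n. (b i)\<^sup>2) = \<rho>})"
    using finB by (subst card_eq_sum, subst sum.group[symmetric, where T = "{..n * m\<^sup>2}" and g = "\<lambda>b. \<Sum>i<n. (b i)\<^sup>2"]) auto
  also have "\<dots> = (\<Sum>\<rho>\<le>n * m\<^sup>2. card (sphere \<rho>))" by (simp add: sphere_def B_def)
  finally have total: "(m + 1) ^ n = (\<Sum>\<rho>\<le>n * m\<^sup>2. card (sphere \<rho>))" by (simp add: B_def card_PiE)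
  have "\<exists>\<rho>\<in>{..n * m\<^sup>2}. (\<Sum>\<rho>\<le>n * m\<^sup>2. real (card (sphere \<rho>))) \<le> real (card {..n * m\<^sup>2}) * real (card (sphere \<rho>))"
    by (rule ex_ge_average) auto
  then obtain \<rho> where "(\<Sum>\<rho>\<le>n * m\<^sup>2. real (card (sphere \<rho>))) \<le> real (card {..n * m\<^sup>2}) * real (card (sphere \<rho>))"
    by blast
  hence "real ((m + 1) ^ n) \<le> real ((n * m\<^sup>2 + 1) * card (sphere \<rho>))" unfolding total by (simp add: algebra_simps)
  thus ?thesis unfolding of_nat_le_iff by blast
qed

lemma card_uniform_ge:
  assumes "N = 6 * k" "k > 0"
  shows "46656 ^ k \<le> 65 * k ^ 5 * card (uniform k)"
proof -
  have six: "card (complete_edges S) = 6" using card_complete_edges[OF finite_S] card_S by (simp add: choose_two)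
  have le: "fact N \<le> card (uniform k) * fact k ^ 6"
    using fact_power_le_card_balanced_words[of "complete_edges S" N k] assms six finite_complete_edges[OF finite_S]
    unfolding uniform_def patterns_def balanced_words_def by simp
  have "46656 ^ k * fact k ^ 6 \<le> 65 * k ^ 5 * (fact N :: nat)"
    unfolding assms(1) by (rule power_le_fact_6_times[OF assms(2)])
  also have "\<dots> \<le> 65 * k ^ 5 * (card (uniform k) * fact k ^ 6)" by (rule mult_left_mono[OF le]) simp
  finally have "46656 ^ k * fact k ^ 6 \<le> (65 * k ^ 5 * card (uniform k)) * fact k ^ 6"
    by (simp only: mult.assoc)
  thus ?thesis by (subst (asm) mult_le_cancel2) auto
qed

end

text \<open>
  With \<open>N = 6 * u\<^sup>2\<close>, the choice \<open>p ^ u = 4 ^ u * 27 ^ u\<^sup>2\<close> is slightly more than \<open>3 powr (N / 2)\<close>. This is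
  the smallest number of hash values, up to subexponential factors, for which conflicts are rarer than survivors. The expected number
  of survivors is then about \<open>6 ^ N / (p ^ u)\<^sup>2\<close>, hence about \<open>2 ^ N = 64 ^ u\<^sup>2\<close>. All losses
  (polynomial factors, the restriction to a sphere, the factors \<open>4 ^ u\<close>) are at most exponential in \<open>u\<close>, hence
  subexponential in \<open>N\<close>.
\<close>

lemma large_free_family:
  fixes S :: "'v set" and u :: nat
  defines "N \<equiv> 6 * u\<^sup>2"
  assumes S: "card S = 4" and u: "u \<ge> 2"
  shows "\<exists>\<Lambda>. \<Lambda> \<subseteq> balanced_words N (u\<^sup>2) (complete_edges S) \<and> leg_free S N \<Lambda> \<and>
           64 ^ u\<^sup>2 \<le> (130 * 1024 * 64 * 2916) ^ u * real (card \<Lambda>)"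
proof -
  obtain root where root: "root \<in> S" using S by (metis card.empty equals0I zero_neq_numeral)
  define p :: nat where "p = 4 * 27 ^ u"
  interpret pair_hashing S root N u "27 ^ u" p
    by standard (simp_all add: S root p_def)
  have u2: "u\<^sup>2 > 0" using u by simp
  obtain \<rho> where \<rho>: "(27 ^ u + 1) ^ u \<le> (u * (27 ^ u)\<^sup>2 + 1) * card (sphere \<rho>)"
    using large_sphere_exists by blast
  have "2 \<le> N" using u2 by (simp add: N_def)
  from free_family_exists[OF this, of "u\<^sup>2" \<rho>] obtain \<Lambda> where \<Lambda>: "\<Lambda> \<subseteq> uniform (u\<^sup>2)"
    "\<forall>z\<in>patterns. \<forall>f. (\<forall>v\<in>S. f v \<in> \<Lambda> \<and> same_support v z (f v)) \<longrightarrow> (\<forall>v\<in>S. f v = z)"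
    "real (card (uniform (u\<^sup>2))) * real (card (sphere \<rho>))
       * (1 - 4 * 3 ^ N / real p ^ (2 * u) - 6 * 2 ^ (4 * u\<^sup>2) / real p ^ u) \<le> real p ^ (3 * u) * real (card \<Lambda>)"
    by blast
  define a :: real where "a = 27 ^ u\<^sup>2"
  have pu: "real p ^ u = 4 ^ u * a"
    by (simp add: p_def a_def power_mult_distrib power2_eq_square flip: power_mult)
  have a3: "a ^ 2 = 729 ^ u\<^sup>2" "a ^ 3 = 19683 ^ u\<^sup>2"
    unfolding a_def by (simp_all add: power_swap[of 27 "u\<^sup>2"])
  have apos: "a > 0" by (simp add: a_def)
  \<comment> \<open>On average, at most half of the surviving words have a conflict.\<close>
  have half: "1 / 2 \<le> 1 - 4 * 3 ^ N / real p ^ (2 * u) - 6 * 2 ^ (4 * u\<^sup>2) / real p ^ u"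
  proof -
    have "(16 :: real) ^ 2 \<le> 16 ^ u" "(4 :: real) ^ 2 \<le> 4 ^ u" using u by (intro power_increasing; simp)+
    hence pw: "(256 :: real) \<le> 16 ^ u" "(16 :: real) \<le> 4 ^ u" by simp_all
    have "real p ^ (2 * u) = (real p ^ u)\<^sup>2" by (simp only: power_mult power_swap[of _ 2 u])
    also have "\<dots> = 16 ^ u * a ^ 2" unfolding pu by (simp add: power_mult_distrib power_swap[of 4 u 2])
    finally have "real p ^ (2 * u) = 16 ^ u * a ^ 2" .
    moreover have "(3 :: real) ^ N = a ^ 2" unfolding a3 N_def by (simp add: power_mult)
    ultimately have 1: "4 * 3 ^ N / real p ^ (2 * u) \<le> 4 / 256" using pw apos by (simp add: field_simps)
    have "(2 :: real) ^ (4 * u\<^sup>2) = 16 ^ u\<^sup>2" by (simp add: power_mult)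
    also have "\<dots> \<le> a" unfolding a_def by (intro power_mono) auto
    finally have "6 * 2 ^ (4 * u\<^sup>2) / real p ^ u \<le> 6 * a / (4 ^ u * a)"
      unfolding pu using apos by (intro divide_right_mono) auto
    also have "\<dots> \<le> 6 / 16" using pw apos by (simp add: field_simps)
    finally show ?thesis using 1 by simp
  qed
  define X where "X = real (card (uniform (u\<^sup>2))) * real (card (sphere \<rho>))"
  have "X * (1 / 2) \<le> X * (1 - 4 * 3 ^ N / real p ^ (2 * u) - 6 * 2 ^ (4 * u\<^sup>2) / real p ^ u)"
    by (intro mult_left_mono half) (simp add: X_def)
  also have "\<dots> \<le> real p ^ (3 * u) * real (card \<Lambda>)" using \<Lambda>(3) by (simp add: X_def)
  also have p3: "real p ^ (3 * u) = 64 ^ u * 19683 ^ u\<^sup>2"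
  proof -
    have "real p ^ (3 * u) = (real p ^ u) ^ 3" by (simp only: power_mult power_swap[of _ 3 u])
    thus ?thesis unfolding pu a3(2) [symmetric] by (simp add: power_mult_distrib power_swap[of 4 u 3])
  qed
  finally have X: "X \<le> 2 * 64 ^ u * 19683 ^ u\<^sup>2 * real (card \<Lambda>)" by simp
  have "real (46656 ^ u\<^sup>2) \<le> real (65 * (u\<^sup>2) ^ 5 * card (uniform (u\<^sup>2)))"
    using card_uniform_ge[OF N_def[THEN meta_eq_to_obj_eq] u2] by (simp only: of_nat_le_iff)
  moreover have "real (27 ^ u\<^sup>2) \<le> real ((u * (27 ^ u)\<^sup>2 + 1) * card (sphere \<rho>))"
  proof -
    have "(27 :: nat) ^ u\<^sup>2 = (27 ^ u) ^ u" by (simp add: power2_eq_square power_mult)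
    also have "\<dots> \<le> (27 ^ u + 1) ^ u" by (intro power_mono) auto
    finally show ?thesis using \<rho> unfolding of_nat_le_iff by linarith
  qed
  ultimately have "real (46656 ^ u\<^sup>2) * real (27 ^ u\<^sup>2) \<le>
      real (65 * (u\<^sup>2) ^ 5 * card (uniform (u\<^sup>2))) * real ((u * (27 ^ u)\<^sup>2 + 1) * card (sphere \<rho>))"
    by (intro mult_mono) auto
  also have "\<dots> = 65 * real u ^ 10 * (real u * 729 ^ u + 1) * X"
  proof -
    have "(27 ^ u)\<^sup>2 = (729 ^ u :: nat)" by (simp add: power_swap[of 27 u 2])
    moreover have "(u\<^sup>2) ^ 5 = u ^ 10" by (simp add: power_mult [symmetric])
    ultimately show ?thesis by (simp add: X_def algebra_simps)
  qed
  also have "\<dots> \<le> 65 * real u ^ 10 * (real u * 729 ^ u + 1) * (2 * 64 ^ u * 19683 ^ u\<^sup>2 * real (card \<Lambda>))"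
    by (intro mult_left_mono X) auto
  \<comment> \<open>\<open>46656 * 27 = 64 * 19683\<close>, that is, \<open>6 ^ 6 * 3 ^ 3 = 2 ^ 6 * 3 ^ 9\<close>.\<close>
  finally have "19683 ^ u\<^sup>2 * (64 ^ u\<^sup>2) \<le>
      19683 ^ u\<^sup>2 * (130 * real u ^ 10 * 64 ^ u * (real u * 729 ^ u + 1) * real (card \<Lambda>))"
    by (simp add: power_mult_distrib [symmetric] mult_ac)
  hence "64 ^ u\<^sup>2 \<le> 130 * real u ^ 10 * 64 ^ u * (real u * 729 ^ u + 1) * real (card \<Lambda>)"
    by (subst (asm) mult_le_cancel_left_pos) auto
  \<comment> \<open>Every factor is at most a constant to the power \<open>u\<close>; the first three come from the count of
    balanced words and from \<open>p ^ (3 * u)\<close>, the last one from the number of spheres.\<close>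
  also have "\<dots> \<le> 130 ^ u * 1024 ^ u * 64 ^ u * 2916 ^ u * real (card \<Lambda>)"
  proof (intro mult_mono)
    have le2: "real u \<le> 2 ^ u" using of_nat_less_two_power[of u, where ?'a = real] by simp
    have "real u ^ 10 \<le> (2 ^ u) ^ 10" using le2 by (intro power_mono) auto
    thus "real u ^ 10 \<le> 1024 ^ u" by (simp add: power_swap[of 2 u 10])
    show "(130 :: real) \<le> 130 ^ u" using u power_increasing[of 1 u "130 :: real"] by simp
    have "(1 :: real) \<le> 1458 ^ u" "(2 :: real) \<le> 2 ^ u" using u power_increasing[of 1 u "2 :: real"] by simp_all
    moreover have "real u * 729 ^ u \<le> 2 ^ u * 729 ^ u" using le2 by (intro mult_right_mono) auto
    moreover have "2 ^ u * 729 ^ u = (1458 :: real) ^ u" by (simp add: power_mult_distrib [symmetric])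
    ultimately have "real u * 729 ^ u + 1 \<le> 2 * 1458 ^ u" by linarith
    also have "\<dots> \<le> 2 ^ u * 1458 ^ u" using \<open>(2 :: real) \<le> 2 ^ u\<close> by (intro mult_right_mono) auto
    also have "\<dots> = 2916 ^ u" by (simp add: power_mult_distrib [symmetric])
    finally show "real u * 729 ^ u + 1 \<le> 2916 ^ u" .
  qed auto
  also have "130 ^ u * 1024 ^ u * 64 ^ u * 2916 ^ u = ((130 * 1024 * 64 * 2916) ^ u :: real)"
    by (simp add: power_mult_distrib [symmetric])
  finally have "64 ^ u\<^sup>2 \<le> (130 * 1024 * 64 * 2916) ^ u * real (card \<Lambda>)" .
  thus ?thesis using \<Lambda>(1,2) 
    unfolding patterns_def uniform_def same_support_def balanced_words_def leg_free_def by blast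
qed

section \<open>From blocks to tensors of complete graphs\<close>

text \<open>
  The tensor of the graph with edge set \<open>E\<close> in which an edge \<open>e\<close> carries one label with \<open>q\<close> values for every
  \<open>t \<in> I e\<close>. Products of such tensors correspond to disjoint unions of the sets \<open>I e\<close>.
\<close>

definition edge_tensor ::
  "'v set set \<Rightarrow> ('v set \<Rightarrow> 's set) \<Rightarrow> nat \<Rightarrow> ('v \<Rightarrow> 'v set \<Rightarrow> 's \<Rightarrow> nat) \<Rightarrow> complex" where
  "edge_tensor E I q x = of_bool (\<forall>e\<in>E. \<forall>t\<in>I e. \<exists>i<q. \<forall>v\<in>e. x v e t = i)"

text \<open>
  The direct sum of the blocks of \<open>\<Lambda>\<close> is a zeroed-out power of \<open>cw_tensor\<close>. At leg \<open>v\<close>, a word \<open>l\<close> together with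
  labels \<open>y\<close> is sent to the index sequence that is nonzero exactly at the positions \<open>j\<close> with \<open>v \<in> l j\<close>, where it
  holds a label of the edge \<open>l j\<close>; the bijections \<open>h\<close> distribute the \<open>k\<close> labels of an edge over the \<open>k\<close>
  positions at which it occurs.
\<close>

lemma rank_le_direct_sum_of_blocks:
  fixes S :: "'v set" and \<Lambda> :: "(nat \<Rightarrow> 'v set) set"
  defines "E \<equiv> complete_edges S"
  assumes S: "finite S" "S \<noteq> {}"
    and balanced: "\<Lambda> \<subseteq> balanced_words N k E" and leg_free: "leg_free S N \<Lambda>"
  shows "rank_le S (\<lambda>x. of_bool (\<exists>l\<in>\<Lambda>. \<forall>v\<in>S. fst (x v) = l) * edge_tensor E (\<lambda>_. {..<k}) q (\<lambda>v. snd (x v)))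
           ((2 * card S * N + 1) * (q + 2) ^ N)"
proof -
  note \<Lambda> = balanced[unfolded balanced_words_def]
  note free = leg_free[unfolded leg_free_def, folded E_def]
  have "\<forall>l\<in>\<Lambda>. \<forall>e\<in>E. \<exists>h. bij_betw h {j. j < N \<and> l j = e} {..<k}"
    using \<Lambda> by (intro ballI finite_same_card_bij) auto
  then obtain h where h: "\<And>l e. l \<in> \<Lambda> \<Longrightarrow> e \<in> E \<Longrightarrow> bij_betw (h l e) {j. j < N \<and> l j = e} {..<k}"
    by metis
  define g :: "'v \<Rightarrow> (nat \<Rightarrow> 'v set) \<times> ('v set \<Rightarrow> nat \<Rightarrow> nat) \<Rightarrow> nat \<Rightarrow> nat" where
    "g = (\<lambda>v (l, y) j. if v \<in> l j then y (l j) (h l (l j) j) + 1 else 0)"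
  have eq: "of_bool (\<exists>l\<in>\<Lambda>. \<forall>v\<in>S. fst (x v) = l) * edge_tensor E (\<lambda>_. {..<k}) q (\<lambda>v. snd (x v)) =
        (\<Prod>v\<in>S. of_bool (fst (x v) \<in> \<Lambda>)) * (\<Prod>j<N. cw_tensor S q (\<lambda>v. g v (x v) j))" for x
  proof -
    have "(\<exists>l\<in>\<Lambda>. \<forall>v\<in>S. fst (x v) = l) \<and> (\<forall>e\<in>E. \<forall>t<k. \<exists>i<q. \<forall>v\<in>e. snd (x v) e t = i) \<longleftrightarrow>
          (\<forall>v\<in>S. fst (x v) \<in> \<Lambda>) \<and>
          (\<forall>j<N. \<exists>e\<in>E. \<exists>i\<in>{1..q}. \<forall>v\<in>S. g v (x v) j = (if v \<in> e then i else 0))"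
      (is "?A \<longleftrightarrow> ?B")
    proof
      assume A: ?A
      then obtain l where l: "l \<in> \<Lambda>" "\<forall>v\<in>S. fst (x v) = l" by blast
      have "\<exists>e\<in>E. \<exists>i\<in>{1..q}. \<forall>v\<in>S. g v (x v) j = (if v \<in> e then i else 0)" if j: "j < N" for j
      proof -
        have e: "l j \<in> E" using l(1) \<Lambda> j by (auto simp: PiE_iff)
        have "h l (l j) j < k" using bij_betwE[OF h[OF l(1) e]] j by blast
        then obtain i where i: "i < q" "\<forall>v\<in>l j. snd (x v) (l j) (h l (l j) j) = i" using A e by blast
        have "g v (x v) j = (if v \<in> l j then i + 1 else 0)" if "v \<in> S" for v
          using l(2) that i(2) by (auto simp: g_def case_prod_beta)
        thus ?thesis using e i(1) by (intro bexI[of _ "l j"] bexI[of _ "i + 1"]) auto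
      qed
      thus ?B using l by auto
    next
      assume B: ?B
      then obtain e i where ei: "\<And>j. j < N \<Longrightarrow> e j \<in> E" "\<And>j. j < N \<Longrightarrow> i j \<in> {1..q}"
        "\<And>j v. j < N \<Longrightarrow> v \<in> S \<Longrightarrow> g v (x v) j = (if v \<in> e j then i j else 0)" by metis
      define z where "z = (\<lambda>j\<in>{..<N}. e j)"
      have zP: "z \<in> {..<N} \<rightarrow>\<^sub>E E" using ei(1) by (auto simp: z_def)
      have supp: "v \<in> z j \<longleftrightarrow> v \<in> fst (x v) j" if "v \<in> S" "j < N" for v j
        using ei(3)[OF that(2,1)] ei(2)[OF that(2)] that(2)
        by (auto simp: g_def z_def case_prod_beta split: if_splits)
      have "\<forall>v\<in>S. fst (x v) \<in> \<Lambda> \<and> (\<forall>j<N. v \<in> z j \<longleftrightarrow> v \<in> fst (x v) j)"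
        using conjunct1[OF B] supp by blast
      hence eqz: "\<forall>v\<in>S. fst (x v) = z"
        by (rule mp[OF spec[OF bspec[OF free zP], of "\<lambda>v. fst (x v)"]])
      hence fz: "fst (x v) = z" if "v \<in> S" for v using that by simp
      obtain v0 where "v0 \<in> S" using S by blast
      hence zL: "z \<in> \<Lambda>" using conjunct1[OF B] fz by metis
      have "\<exists>i<q. \<forall>v\<in>d. snd (x v) d t = i" if d: "d \<in> E" "t < k" for d t
      proof -
        have "t \<in> h z d ` {j. j < N \<and> z j = d}"
          using bij_betw_imp_surj_on[OF h[OF zL d(1)]] d(2) by simp
        then obtain j where j: "j < N" "z j = d" "h z d j = t" by blast
        have "snd (x v) d t = i j - 1" if "v \<in> d" for v
        proof -
          have v: "v \<in> S" using that d(1) by (auto simp: E_def complete_edges_def)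
          have "e j = d" using j(1,2) by (simp add: z_def)
          hence "g v (x v) j = i j" using ei(3)[OF j(1) v] that by simp
          moreover have "g v (x v) j = snd (x v) d t + 1"
            unfolding g_def case_prod_beta fz[OF v] j(2,3) using that by simp
          ultimately show ?thesis by simp
        qed
        thus ?thesis using ei(2)[OF j(1)] by (intro exI[of _ "i j - 1"]) auto
      qed
      thus ?A using eqz zL by blast
    qed
    hence "(of_bool ((\<exists>l\<in>\<Lambda>. \<forall>v\<in>S. fst (x v) = l) \<and> (\<forall>e\<in>E. \<forall>t<k. \<exists>i<q. \<forall>v\<in>e. snd (x v) e t = i)) :: complex) =
        of_bool ((\<forall>v\<in>S. fst (x v) \<in> \<Lambda>) \<and> (\<forall>j\<in>{..<N}. \<exists>e\<in>E. \<exists>i\<in>{1..q}. \<forall>v\<in>S. g v (x v) j = (if v \<in> e then i else 0)))"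
      by (simp only: lessThan_iff Ball_def)
    thus ?thesis
      unfolding of_bool_conj edge_tensor_def cw_tensor_def E_def [symmetric] prod_of_bool[OF S(1)] prod_of_bool[OF finite_lessThan]
      by (simp only: lessThan_iff Ball_def)
  qed
  have "rank_le S (\<lambda>x. \<Prod>j<N. cw_tensor S q (\<lambda>v. g v (x v) j)) ((2 * card S * N + 1) * (q + 2) ^ N)"
    by (rule rank_le_pullback[OF rank_le_cw_power[OF S], where g = g])
  from rank_le_mult[OF rank_le_product[of S "\<lambda>_ b. of_bool (fst b \<in> \<Lambda>)"] this]
  show ?thesis unfolding eq by (simp only: mult_1)
qed

text \<open>
  Each further factor multiplies the rank by \<open>t\<close> instead of \<open>R\<close>, because a group of \<open>card \<Lambda>\<close> terms is
  multiplied by that factor at the price \<open>R\<close> of one direct sum.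
\<close>

lemma rank_le_edge_tensor_powers:
  fixes V :: "'v set" and \<Lambda> :: "'l set" and K :: "'s set"
  assumes V: "finite V" "V \<noteq> {}" and \<Lambda>: "finite \<Lambda>" "\<Lambda> \<noteq> {}"
    and sum: "rank_le V (\<lambda>x. of_bool (\<exists>l\<in>\<Lambda>. \<forall>v\<in>V. fst (x v) = l) * edge_tensor E (\<lambda>_. K) q (\<lambda>v. snd (x v))) R"
    and R: "R \<le> card \<Lambda> * t"
  shows "rank_le V (edge_tensor E (\<lambda>_. {..<s} \<times> K) q) (card \<Lambda> * t ^ s)"
proof (induction s)
  case 0
  have "edge_tensor E (\<lambda>_. {..<0 :: nat} \<times> K) q = (\<lambda>x. \<Prod>v\<in>V. 1)" by (simp add: edge_tensor_def fun_eq_iff)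
  moreover have "rank_le V (\<lambda>x :: 'v \<Rightarrow> 'v set \<Rightarrow> nat \<times> 's \<Rightarrow> nat. \<Prod>v\<in>V. 1) 1" by (rule rank_le_product)
  moreover have "1 \<le> card \<Lambda>" using \<Lambda> by (simp add: Suc_le_eq card_gt_0_iff)
  ultimately show ?case by (simp add: rank_le_mono)
next
  case (Suc s)
  have split: "edge_tensor E (\<lambda>_. {..<Suc s} \<times> K) q =
      (\<lambda>x. edge_tensor E (\<lambda>_. {..<s} \<times> K) q x * edge_tensor E (\<lambda>_. K) q (\<lambda>v. (\<lambda>e t. x v e (s, t))))"
  proof (rule ext)
    fix x :: "'v \<Rightarrow> 'v set \<Rightarrow> nat \<times> 's \<Rightarrow> nat"
    have "(\<forall>e\<in>E. \<forall>t\<in>{..<Suc s} \<times> K. \<exists>i<q. \<forall>v\<in>e. x v e t = i) \<longleftrightarrow>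
      (\<forall>e\<in>E. \<forall>t\<in>{..<s} \<times> K. \<exists>i<q. \<forall>v\<in>e. x v e t = i) \<and> (\<forall>e\<in>E. \<forall>t\<in>K. \<exists>i<q. \<forall>v\<in>e. x v e (s, t) = i)"
    proof -
      have "{..<Suc s} \<times> K = {..<s} \<times> K \<union> {s} \<times> K" by auto
      thus ?thesis by (simp only: ball_Un ball_conj_distrib) simp
    qed
    thus "edge_tensor E (\<lambda>_. {..<Suc s} \<times> K) q x =
        edge_tensor E (\<lambda>_. {..<s} \<times> K) q x * edge_tensor E (\<lambda>_. K) q (\<lambda>v. (\<lambda>e t. x v e (s, t)))"
      by (simp add: edge_tensor_def)
  qed
  have "rank_le V (\<lambda>x. edge_tensor E (\<lambda>_. {..<s} \<times> K) q x * edge_tensor E (\<lambda>_. K) q (\<lambda>v. (\<lambda>e t. x v e (s, t)))) (R * t ^ s)"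
  proof (rule rank_le_mult_by_direct_sum[OF V \<Lambda>(1) _ Suc.IH])
    show "rank_le V (\<lambda>x. of_bool (\<exists>l\<in>\<Lambda>. \<forall>v\<in>V. fst (x v) = l) *
        edge_tensor E (\<lambda>_. K) q (\<lambda>v. (\<lambda>e t. snd (x v) e (s, t)))) R"
      using rank_le_pullback[OF sum, of "\<lambda>_ (l, y). (l, \<lambda>e t. y e (s, t))"] by (simp add: case_prod_beta)
  qed simp
  moreover have "R * t ^ s \<le> card \<Lambda> * t ^ Suc s" using R mult_right_mono[of R "card \<Lambda> * t" "t ^ s"] by (simp add: mult_ac)
  ultimately show ?case unfolding split by (rule rank_le_mono)
qed

text \<open>
  The product of the tensors of all four-subsets gives every pair one batch of labels for each four-subset that
  contains it.
\<close>

lemma rank_le_complete_graph_from_four_subsets: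
  fixes V :: "'v set" and K :: "'s set"
  assumes V: "finite V"
    and r: "\<And>S. S \<subseteq> V \<Longrightarrow> card S = 4 \<Longrightarrow> rank_le S (edge_tensor (complete_edges S) (\<lambda>_. K) q) r"
  shows "rank_le V (edge_tensor (complete_edges V) (\<lambda>e. {S. S \<subseteq> V \<and> card S = 4 \<and> e \<subseteq> S} \<times> K) q) (r ^ (card V choose 4))"
proof -
  define Q where "Q = {S. S \<subseteq> V \<and> card S = 4}"
  have Q: "finite Q" "card Q = card V choose 4" using V by (simp_all add: Q_def n_subsets)
  have "edge_tensor (complete_edges V) (\<lambda>e. {S. S \<subseteq> V \<and> card S = 4 \<and> e \<subseteq> S} \<times> K) q =
      (\<lambda>x. \<Prod>S\<in>Q. edge_tensor (complete_edges S) (\<lambda>_. K) q (\<lambda>v. (\<lambda>e t. x v e (S, t))))"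
  proof (rule ext)
    fix x :: "'v \<Rightarrow> 'v set \<Rightarrow> 'v set \<times> 's \<Rightarrow> nat"
    have "(\<forall>e\<in>complete_edges V. \<forall>t\<in>{S. S \<subseteq> V \<and> card S = 4 \<and> e \<subseteq> S} \<times> K. \<exists>i<q. \<forall>v\<in>e. x v e t = i) \<longleftrightarrow>
          (\<forall>S\<in>Q. \<forall>e\<in>complete_edges S. \<forall>t\<in>K. \<exists>i<q. \<forall>v\<in>e. x v e (S, t) = i)"
      by (fastforce simp: Q_def complete_edges_def)
    thus "edge_tensor (complete_edges V) (\<lambda>e. {S. S \<subseteq> V \<and> card S = 4 \<and> e \<subseteq> S} \<times> K) q x =
        (\<Prod>S\<in>Q. edge_tensor (complete_edges S) (\<lambda>_. K) q (\<lambda>v. (\<lambda>e t. x v e (S, t))))"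
      using Q(1) by (simp add: edge_tensor_def prod_of_bool)
  qed
  moreover have "rank_le V (\<lambda>x. \<Prod>S\<in>Q. edge_tensor (complete_edges S) (\<lambda>_. K) q (\<lambda>v. (\<lambda>e t. x v e (S, t)))) (\<Prod>S\<in>Q. r)"
  proof (intro rank_le_prod Q)
    fix S assume S: "S \<in> Q"
    have "rank_le S (\<lambda>x. edge_tensor (complete_edges S) (\<lambda>_. K) q (\<lambda>v. (\<lambda>e t. x v e (S, t)))) r"
      using rank_le_pullback[OF r, of S "\<lambda>_ y e t. y e (S, t)"] S by (simp add: Q_def)
    thus "rank_le V (\<lambda>x. edge_tensor (complete_edges S) (\<lambda>_. K) q (\<lambda>v. (\<lambda>e t. x v e (S, t)))) r"
      by (rule rank_le_more_legs) (use S V in \<open>auto simp: Q_def\<close>)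
  qed
  ultimately show ?thesis using Q by simp
qed

lemma card_four_subsets_containing:
  assumes V: "finite V" and e: "e \<in> complete_edges V"
  shows "card {S. S \<subseteq> V \<and> card S = 4 \<and> e \<subseteq> S} = (card V - 2) choose 2"
proof -
  have e': "e \<subseteq> V" "card e = 2" "finite e" using e V by (auto simp: complete_edges_def finite_subset)
  have "bij_betw (\<lambda>A. A \<union> e) {A. A \<subseteq> V - e \<and> card A = 2} {S. S \<subseteq> V \<and> card S = 4 \<and> e \<subseteq> S}"
  proof (rule bij_betw_byWitness[where f' = "\<lambda>S. S - e"])
    show "(\<lambda>A. A \<union> e) ` {A. A \<subseteq> V - e \<and> card A = 2} \<subseteq> {S. S \<subseteq> V \<and> card S = 4 \<and> e \<subseteq> S}"
    proof (rule image_subsetI)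
      fix A assume A: "A \<in> {A. A \<subseteq> V - e \<and> card A = 2}"
      hence "card (A \<union> e) = card A + card e" using V e' by (intro card_Un_disjoint) (auto intro: finite_subset)
      thus "A \<union> e \<in> {S. S \<subseteq> V \<and> card S = 4 \<and> e \<subseteq> S}" using A e' by auto
    qed
    show "(\<lambda>S. S - e) ` {S. S \<subseteq> V \<and> card S = 4 \<and> e \<subseteq> S} \<subseteq> {A. A \<subseteq> V - e \<and> card A = 2}"
      using e' by (auto simp: card_Diff_subset)
  qed auto
  hence "card {S. S \<subseteq> V \<and> card S = 4 \<and> e \<subseteq> S} = card {A. A \<subseteq> V - e \<and> card A = 2}"
    by (simp add: bij_betw_same_card)
  also have "\<dots> = card (V - e) choose 2" using V by (simp add: n_subsets)
  finally show ?thesis using V e' by (simp add: card_Diff_subset)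
qed

text \<open>
  The coefficients of the \<open>n\<close>-th power of \<open>graph_tensor 2 V E\<close>, extended to functions that are not basis indices: labels
  out of range give 0, and values at positions or edges without meaning are ignored.
\<close>

definition graph_power_function :: "'v set set \<Rightarrow> nat \<Rightarrow> ('v \<Rightarrow> nat \<Rightarrow> 'v set \<Rightarrow> nat) \<Rightarrow> complex" where
  "graph_power_function E n x = of_bool (\<forall>e\<in>E. \<forall>j<n. \<exists>i\<in>{1..2}. \<forall>v\<in>e. x v j e = i)"

text \<open>
  The \<open>n\<close> two-valued labels of an edge are encoded injectively by its labels with \<open>q\<close> values. Index sequences that are
  not of the right form are sent to the invalid label \<open>q\<close>, so that the coefficient vanishes.
\<close>

lemma rank_le_graph_power_function:
  fixes V :: "'v set" and J :: "'v set \<Rightarrow> 's set"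
  assumes r: "rank_le V (edge_tensor E J q) r"
    and E: "\<And>e. e \<in> E \<Longrightarrow> e \<noteq> {} \<and> finite (J e) \<and> 2 ^ n \<le> q ^ card (J e)"
  shows "rank_le V (graph_power_function E n) r"
proof -
  define B where "B = {..<n} \<rightarrow>\<^sub>E {1..2 :: nat}"
  have finB: "finite B" by (auto simp: B_def intro: finite_PiE)
  have "\<exists>h. h ` B \<subseteq> J e \<rightarrow>\<^sub>E {..<q} \<and> inj_on h B" if "e \<in> E" for e
    using E[OF that] finB by (intro card_le_inj) (auto simp: card_PiE B_def intro: finite_PiE)
  then obtain h where h: "\<And>e. e \<in> E \<Longrightarrow> h e ` B \<subseteq> J e \<rightarrow>\<^sub>E {..<q}" "\<And>e. e \<in> E \<Longrightarrow> inj_on (h e) B" by metis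
  define w where "w = (\<lambda>(y :: nat \<Rightarrow> 'v set \<Rightarrow> nat) e. \<lambda>j\<in>{..<n}. y j e)"
  define g where "g = (\<lambda>(v :: 'v) y e t. if w y e \<in> B then h e (w y e) t else q)"
  have "graph_power_function E n x = edge_tensor E J q (\<lambda>v. g v (x v))" for x
  proof -
    have "(\<forall>j<n. \<exists>i\<in>{1..2}. \<forall>v\<in>e. x v j e = i) \<longleftrightarrow> (\<forall>t\<in>J e. \<exists>i<q. \<forall>v\<in>e. g v (x v) e t = i)" (is "?L \<longleftrightarrow> ?R")
      if e: "e \<in> E" for e
    proof -
      obtain v0 where v0: "v0 \<in> e" using E[OF e] by blast
      show ?thesis
      proof
        assume L: ?L
        have same: "w (x v) e = w (x v0) e" if "v \<in> e" for v
          unfolding w_def using L that v0 by (intro restrict_ext) (metis lessThan_iff)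
        have wB: "w (x v0) e \<in> B" using L v0 by (auto simp: w_def B_def)
        show ?R
        proof (intro ballI exI[of _ "h e (w (x v0) e) _"] conjI)
          fix t v assume "t \<in> J e"
          thus "h e (w (x v0) e) t < q" using h(1)[OF e] wB by (auto simp: PiE_iff image_subset_iff)
          assume "v \<in> e"
          thus "g v (x v) e t = h e (w (x v0) e) t" using same wB by (simp add: g_def)
        qed
      next
        assume R: ?R
        show ?L
        proof (intro allI impI)
          fix j assume j: "j < n"
          have "(2 :: nat) ^ 1 \<le> 2 ^ n" using j by (intro power_increasing) auto
          hence "J e \<noteq> {}" using E[OF e] by auto
          then obtain t0 where t0: "t0 \<in> J e" by blast
          have wB: "w (x v) e \<in> B" if "v \<in> e" for v
            using R t0 that by (auto simp: g_def split: if_splits)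
          have "h e (w (x v) e) = h e (w (x v0) e)" if "v \<in> e" for v
          proof (rule PiE_ext)
            show "h e (w (x v) e) \<in> J e \<rightarrow>\<^sub>E {..<q}" "h e (w (x v0) e) \<in> J e \<rightarrow>\<^sub>E {..<q}"
              using h(1)[OF e] wB that v0 by blast+
            fix t assume "t \<in> J e"
            then obtain i where "\<forall>v\<in>e. g v (x v) e t = i" using R by blast
            thus "h e (w (x v) e) t = h e (w (x v0) e) t" using wB that v0 by (simp add: g_def)
          qed
          hence same: "w (x v) e = w (x v0) e" if "v \<in> e" for v
            using inj_onD[OF h(2)[OF e]] wB that v0 by blast
          have "x v j e = x v0 j e" if "v \<in> e" for v
            using fun_cong[OF same[OF that], of j] j by (simp add: w_def)
          moreover have "x v0 j e \<in> {1..2}" using wB[OF v0] j by (auto simp: w_def B_def PiE_iff)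
          ultimately show "\<exists>i\<in>{1..2}. \<forall>v\<in>e. x v j e = i" by blast
        qed
      qed
    qed
    thus ?thesis by (simp add: graph_power_function_def edge_tensor_def)
  qed
  hence "graph_power_function E n = (\<lambda>x. edge_tensor E J q (\<lambda>v. g v (x v)))" by (rule ext)
  thus ?thesis using rank_le_pullback[OF r, of g] by simp
qed

section \<open>The exponent as a limit of ranks\<close>

text \<open>
  The \<open>m\<close>-th power of the unit tensor is a diagonal tensor of size \<open>2 ^ m\<close>, so restricting it means summing one product
  of matrix entries for every diagonal entry.
\<close>

lemma restricts_to_unit_power_iff:
  fixes V :: "'v set" and \<psi> :: "('v, 'c) tensor"
  assumes V: "finite V" and legs: "legs \<psi> = V"
  shows "restricts_to (tensor_power (unit_tensor V) m) \<psi> \<longleftrightarrow>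
    (\<exists>A :: 'v \<Rightarrow> 'c \<Rightarrow> (nat \<Rightarrow> nat) \<Rightarrow> complex. \<forall>y\<in>(\<Pi>\<^sub>E v\<in>V. basis \<psi> v).
       tensor.coeff \<psi> y = (\<Sum>i\<in>{..<m} \<rightarrow>\<^sub>E {1..2}. \<Prod>v\<in>V. A v (y v) i))"
proof -
  define W where "W = {..<m} \<rightarrow>\<^sub>E {1..2 :: nat}"
  have finW: "finite W" by (auto simp: W_def intro: finite_PiE)
  have unit: "(\<Prod>j<m. tensor.coeff (unit_tensor V) (\<lambda>v\<in>V. x v j)) = (\<Sum>g\<in>W. \<Prod>v\<in>V. of_bool (g = x v))"
    if x: "x \<in> V \<rightarrow>\<^sub>E W" for x
  proof -
    have "(\<Prod>j<m. tensor.coeff (unit_tensor V) (\<lambda>v\<in>V. x v j)) = (\<Prod>j<m. \<Sum>i\<in>{1..2}. \<Prod>v\<in>V. of_bool (i = x v j))"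
      by (simp add: unit_tensor_def basis_vec_def)
    also have "\<dots> = (\<Sum>g\<in>W. \<Prod>j<m. \<Prod>v\<in>V. of_bool (g j = x v j))"
      unfolding W_def by (rule prod_sum_PiE) auto
    also have "\<dots> = (\<Sum>g\<in>W. \<Prod>v\<in>V. of_bool (g = x v))"
    proof (rule sum.cong[OF refl])
      fix g assume g: "g \<in> W"
      have "(\<Prod>j<m. of_bool (g j = x v j)) = (of_bool (g = x v) :: complex)" if v: "v \<in> V" for v
      proof -
        have "x v \<in> W" using x v by (rule PiE_mem)
        hence "(\<forall>j\<in>{..<m}. g j = x v j) \<longleftrightarrow> g = x v"
          using g PiE_ext[of g "{..<m}" "\<lambda>_. {1..2}" "x v"] unfolding W_def by blast
        thus ?thesis by (simp add: prod_of_bool)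
      qed
      thus "(\<Prod>j<m. \<Prod>v\<in>V. of_bool (g j = x v j)) = (\<Prod>v\<in>V. of_bool (g = x v) :: complex)"
        by (subst prod.swap) simp
    qed
    finally show ?thesis .
  qed
  have contract: "(\<Sum>x\<in>V \<rightarrow>\<^sub>E W. (\<Prod>v\<in>V. A v (y v) (x v)) * (\<Prod>j<m. tensor.coeff (unit_tensor V) (\<lambda>v\<in>V. x v j))) =
      (\<Sum>i\<in>W. \<Prod>v\<in>V. A v (y v) i)" for A :: "'v \<Rightarrow> 'c \<Rightarrow> (nat \<Rightarrow> nat) \<Rightarrow> complex" and y
  proof -
    have "(\<Sum>x\<in>V \<rightarrow>\<^sub>E W. (\<Prod>v\<in>V. A v (y v) (x v)) * (\<Prod>j<m. tensor.coeff (unit_tensor V) (\<lambda>v\<in>V. x v j))) =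
          (\<Sum>x\<in>V \<rightarrow>\<^sub>E W. \<Sum>g\<in>W. \<Prod>v\<in>V. A v (y v) (x v) * of_bool (g = x v))"
      by (intro sum.cong refl) (simp add: unit sum_distrib_left prod.distrib)
    also have "\<dots> = (\<Sum>g\<in>W. \<Sum>x\<in>V \<rightarrow>\<^sub>E W. \<Prod>v\<in>V. A v (y v) (x v) * of_bool (g = x v))"
      by (rule sum.swap)
    also have "\<dots> = (\<Sum>g\<in>W. \<Prod>v\<in>V. \<Sum>b\<in>W. A v (y v) b * of_bool (g = b))"
      using V finW by (intro sum.cong refl prod_sum_PiE [symmetric]) auto
    also have "\<dots> = (\<Sum>i\<in>W. \<Prod>v\<in>V. A v (y v) i)"
    proof (intro sum.cong prod.cong refl)
      fix g v assume "g \<in> W"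
      have "(\<Sum>b\<in>W. A v (y v) b * of_bool (g = b)) = (\<Sum>b\<in>W. if g = b then A v (y v) b else 0)"
        by (intro sum.cong) auto
      thus "(\<Sum>b\<in>W. A v (y v) b * of_bool (g = b)) = A v (y v) g"
        using \<open>g \<in> W\<close> finW by simp
    qed
    finally show ?thesis .
  qed
  have parts: "legs (tensor_power (unit_tensor V) m) = V" "basis (tensor_power (unit_tensor V) m) = (\<lambda>v. W)"
    "tensor.coeff (tensor_power (unit_tensor V) m) x = (\<Prod>j<m. tensor.coeff (unit_tensor V) (\<lambda>v\<in>V. x v j))" for x
    by (simp_all add: tensor_power_def unit_tensor_def W_def)
  show ?thesis
    unfolding restricts_to_def parts legs contract W_def [symmetric] by simp
qed

lemma coeff_graph_tensor_power:
  assumes V: "finite V" and E: "finite E" "\<And>e. e \<in> E \<Longrightarrow> e \<subseteq> V \<and> e \<noteq> {}"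
  shows "tensor.coeff (tensor_power (graph_tensor 2 V E) n) y = graph_power_function E n y"
proof -
  have one: "tensor.coeff (graph_tensor 2 V E) (\<lambda>v\<in>V. y v j) = of_bool (\<forall>e\<in>E. \<exists>a\<in>{1..2}. \<forall>v\<in>e. y v j e = a)" for j
  proof -
    have "tensor.coeff (graph_tensor 2 V E) (\<lambda>v\<in>V. y v j) =
        (\<Sum>i\<in>E \<rightarrow>\<^sub>E {1..2}. \<Prod>v\<in>V. \<Prod>e\<in>{e \<in> E. v \<in> e}. of_bool (i e = y v j e))"
      by (simp add: graph_tensor_def basis_vec_def)
    also have "\<dots> = (\<Sum>i\<in>E \<rightarrow>\<^sub>E {1..2}. \<Prod>e\<in>E. \<Prod>v\<in>{v \<in> V. v \<in> e}. of_bool (i e = y v j e))"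
      by (intro sum.cong refl prod.swap_restrict V E)
    also have "\<dots> = (\<Prod>e\<in>E. \<Sum>a\<in>{1..2}. \<Prod>v\<in>{v \<in> V. v \<in> e}. of_bool (a = y v j e))"
      using E by (intro prod_sum_PiE [symmetric]) auto
    also have "\<dots> = (\<Prod>e\<in>E. of_bool (\<exists>a\<in>{1..2}. \<forall>v\<in>e. y v j e = a))"
    proof (intro prod.cong refl)
      fix e assume e: "e \<in> E"
      then obtain v0 where v0: "v0 \<in> e" using E by blast
      have ev: "{v \<in> V. v \<in> e} = e" "finite e" using E(2)[OF e] V by (auto intro: finite_subset)
      define P where "P = (\<exists>a\<in>{1..2}. \<forall>v\<in>e. y v j e = a)"
      have "(\<Sum>a\<in>{1..2}. \<Prod>v\<in>{v \<in> V. v \<in> e}. of_bool (a = y v j e)) =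
            (\<Sum>a\<in>{1..2}. if a = y v0 j e then of_bool P else (0 :: complex))"
      proof (intro sum.cong refl)
        fix a :: nat assume "a \<in> {1..2}"
        hence "(\<forall>v\<in>e. a = y v j e) \<longleftrightarrow> a = y v0 j e \<and> P" unfolding P_def using v0 by metis
        thus "(\<Prod>v\<in>{v \<in> V. v \<in> e}. of_bool (a = y v j e)) = (if a = y v0 j e then of_bool P else (0 :: complex))"
          unfolding ev(1) prod_of_bool[OF ev(2)] by simp
      qed
      also have "\<dots> = of_bool P"
      proof -
        have "y v0 j e \<in> {1..2}" if P using that v0 unfolding P_def by metis
        thus ?thesis by (cases P) simp_all
      qed
      finally show "(\<Sum>a\<in>{1..2}. \<Prod>v\<in>{v \<in> V. v \<in> e}. of_bool (a = y v j e)) =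
            (of_bool (\<exists>a\<in>{1..2}. \<forall>v\<in>e. y v j e = a) :: complex)" by (simp only: P_def)
    qed
    finally show ?thesis using E(1) by (simp add: prod_of_bool)
  qed
  have power: "tensor.coeff (tensor_power (graph_tensor 2 V E) n) y = (\<Prod>j<n. tensor.coeff (graph_tensor 2 V E) (\<lambda>v\<in>V. y v j))"
    by (simp add: tensor_power_def) (simp add: graph_tensor_def)
  show ?thesis unfolding power one prod_of_bool[OF finite_lessThan] graph_power_function_def
    by (intro arg_cong[where f = of_bool]) blast
qed

text \<open>
  Restriction only constrains coefficients at basis indices, whereas \<open>rank_le\<close> constrains all values. The difference
  is bridged by replacing an arbitrary index with its canonical representative, or the whole factor with zero if that is not a
  basis index.
\<close>

lemma restricts_to_graph_power_iff_rank_le: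
  fixes V :: "'v set"
  assumes V: "finite V" "V \<noteq> {}" and E: "finite E" "\<And>e. e \<in> E \<Longrightarrow> e \<subseteq> V \<and> e \<noteq> {}"
  shows "restricts_to (tensor_power (unit_tensor V) m) (tensor_power (graph_tensor 2 V E) n) \<longleftrightarrow>
           rank_le V (graph_power_function E n) (2 ^ m)"
proof -
  define W where "W = {..<m} \<rightarrow>\<^sub>E {1..2 :: nat}"
  have W: "finite W" "card W = 2 ^ m" by (auto simp: W_def card_PiE intro: finite_PiE)
  define B where "B = (\<lambda>v :: 'v. {..<n} \<rightarrow>\<^sub>E ({e \<in> E. v \<in> e} \<rightarrow>\<^sub>E {1..2 :: nat}))"
  let ?F = "graph_power_function E n"
  have legs: "legs (tensor_power (graph_tensor 2 V E) n) = V" by (simp add: tensor_power_def graph_tensor_def)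
  have coeff: "tensor.coeff (tensor_power (graph_tensor 2 V E) n) y = ?F y" for y
    by (rule coeff_graph_tensor_power[OF V(1) E])
  have basis: "basis (tensor_power (graph_tensor 2 V E) n) = B"
    by (simp add: tensor_power_def graph_tensor_def B_def)
  have "(\<exists>A. \<forall>y\<in>Pi\<^sub>E V B. ?F y = (\<Sum>i\<in>W. \<Prod>v\<in>V. A v (y v) i)) \<longleftrightarrow> rank_le V ?F (2 ^ m)" (is "?L \<longleftrightarrow> ?R")
  proof
    assume ?R
    then obtain I u where I: "finite (I :: nat set)" "card I \<le> 2 ^ m" "\<forall>x. ?F x = (\<Sum>i\<in>I. \<Prod>v\<in>V. u i v (x v))"
      by (rule rank_leE)
    obtain h where h: "h ` I \<subseteq> W" "inj_on h I" using card_le_inj[OF I(1) W(1)] I(2) W(2) by auto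
    \<comment> \<open>Diagonal entries without a product get the zero map; as \<open>V\<close> is nonempty, they contribute 0.\<close>
    define A where "A = (\<lambda>v b w. if w \<in> h ` I then u (the_inv_into I h w) v b else 0)"
    have "?F y = (\<Sum>i\<in>W. \<Prod>v\<in>V. A v (y v) i)" for y
    proof -
      have "(\<Sum>w\<in>W. \<Prod>v\<in>V. A v (y v) w) = (\<Sum>w\<in>h ` I. \<Prod>v\<in>V. A v (y v) w)"
        using V W(1) h(1) by (intro sum.mono_neutral_right) (auto simp: A_def)
      also have "\<dots> = (\<Sum>i\<in>I. \<Prod>v\<in>V. u i v (y v))"
        by (subst sum.reindex[OF h(2)]) (simp add: A_def the_inv_into_f_f[OF h(2)])
      finally show ?thesis using I(3) by simp
    qed
    thus ?L by blast
  next
    assume ?L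
    then obtain A where A: "\<forall>y\<in>Pi\<^sub>E V B. ?F y = (\<Sum>i\<in>W. \<Prod>v\<in>V. A v (y v) i)" by blast
    define c where "c = (\<lambda>(v :: 'v) (b :: nat \<Rightarrow> 'v set \<Rightarrow> nat). \<lambda>j\<in>{..<n}. \<lambda>e\<in>{e \<in> E. v \<in> e}. b j e)"
    show ?R
    proof (rule rank_leI[of W _ _ "\<lambda>w v b. if c v b \<in> B v then A v (c v b) w else 0" V])
      fix x :: "'v \<Rightarrow> nat \<Rightarrow> 'v set \<Rightarrow> nat"
      show "?F x = (\<Sum>w\<in>W. \<Prod>v\<in>V. if c v (x v) \<in> B v then A v (c v (x v)) w else 0)"
      proof (cases "\<forall>v\<in>V. c v (x v) \<in> B v")
        case True
        define y where "y = (\<lambda>v\<in>V. c v (x v))"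
        have "y \<in> Pi\<^sub>E V B" using True by (auto simp: y_def)
        moreover have "?F x = ?F y"
        proof -
          have "y v j e = x v j e" if "e \<in> E" "v \<in> e" "j < n" for v j e
            using that E(2)[OF that(1)] by (auto simp: y_def c_def)
          thus ?thesis by (simp add: graph_power_function_def)
        qed
        ultimately have "?F x = (\<Sum>w\<in>W. \<Prod>v\<in>V. A v (y v) w)" using A by simp
        also have "\<dots> = (\<Sum>w\<in>W. \<Prod>v\<in>V. if c v (x v) \<in> B v then A v (c v (x v)) w else 0)"
          using True by (intro sum.cong prod.cong refl) (simp add: y_def)
        finally show ?thesis .
      next
        case False
        then obtain v where v: "v \<in> V" "c v (x v) \<notin> B v" by blast
        have "\<exists>j<n. \<exists>e\<in>E. v \<in> e \<and> x v j e \<notin> {1..2}"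
        proof (rule ccontr)
          assume "\<not> ?thesis"
          hence "\<forall>j<n. \<forall>e\<in>E. v \<in> e \<longrightarrow> x v j e \<in> {1..2}" by blast
          hence "c v (x v) \<in> B v" unfolding c_def B_def restrict_PiE_iff by simp
          thus False using v(2) by contradiction
        qed
        then obtain j e where je: "j < n" "e \<in> E" "v \<in> e" "x v j e \<notin> {1..2}" by blast
        have "\<not> (\<exists>i\<in>{1..2}. \<forall>v\<in>e. x v j e = i)" using je(3,4) by metis
        hence "?F x = 0" using je(1,2) unfolding graph_power_function_def by (subst of_bool_eq_0_iff) blast
        moreover have "(\<Prod>v\<in>V. if c v (x v) \<in> B v then A v (c v (x v)) w else 0) = 0" for w
          using V v by (intro prod_zero) auto
        ultimately show ?thesis by simp
      qed
    qed (use W in auto)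
  qed
  thus ?thesis
    unfolding restricts_to_unit_power_iff[OF V(1) legs] basis coeff W_def .
qed

text \<open>
  Fekete's subadditive lemma: dividing \<open>n\<close> by a fixed \<open>N\<close> with \<open>a N / N\<close> close to the infimum gives
  \<open>a n \<le> n * (a N / N) + O(1)\<close>.
\<close>

lemma fekete:
  fixes a :: "nat \<Rightarrow> real"
  assumes nonneg: "\<And>n. 0 \<le> a n" and sub: "\<And>m n. a (m + n) \<le> a m + a n"
  obtains L where "(\<lambda>n. a n / real n) \<longlonglongrightarrow> L" "0 \<le> L" "\<And>n. n > 0 \<Longrightarrow> L \<le> a n / real n"
proof -
  define L where "L = (INF n\<in>{0<..}. a n / real n)"
  have bdd: "bdd_below ((\<lambda>n. a n / real n) ` {0<..})"
    by (rule bdd_belowI[of _ 0]) (auto simp: nonneg)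
  have le: "L \<le> a n / real n" if "n > 0" for n
    unfolding L_def using that by (intro cINF_lower[OF bdd]) auto
  have "0 \<le> L" unfolding L_def by (intro cINF_greatest) (auto simp: nonneg)
  have mult: "a (q * N + r) \<le> real q * a N + a r" for q N r
  proof (induction q)
    case (Suc q)
    have "a (Suc q * N + r) \<le> a N + a (q * N + r)" using sub[of N "q * N + r"] by (simp add: add_ac)
    thus ?case using Suc.IH by (simp add: algebra_simps)
  qed simp
  have "(\<lambda>n. a n / real n) \<longlonglongrightarrow> L"
  proof (rule LIMSEQ_I)
    fix \<epsilon> :: real assume \<epsilon>: "0 < \<epsilon>"
    have "\<exists>n\<in>{0<..}. a n / real n < L + \<epsilon> / 2"
      unfolding L_def using cINF_less_iff[OF _ bdd, of "L + \<epsilon> / 2"] \<epsilon> by (simp add: L_def)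
    then obtain N where N: "N > 0" "a N / real N < L + \<epsilon> / 2" by auto
    define B where "B = (\<Sum>r<N. a r)"
    have aB: "a r \<le> B" if "r < N" for r
      unfolding B_def using that by (intro member_le_sum) (auto simp: nonneg)
    obtain M :: nat where M: "2 * B / \<epsilon> < real M" using reals_Archimedean2 by blast
    show "\<exists>M. \<forall>n\<ge>M. norm (a n / real n - L) < \<epsilon>"
    proof (intro exI[of _ "Suc M"] allI impI)
      fix n assume n: "Suc M \<le> n"
      have n0: "real n > 0" using n by simp
      have "a n \<le> real (n div N) * a N + a (n mod N)" using mult[of "n div N" N "n mod N"] by simp
      also have "real (n div N) * a N = real (n div N) * real N * (a N / real N)" using N by simp
      also have "\<dots> \<le> real n * (a N / real N)"
      proof (intro mult_right_mono)
        show "real (n div N) * real N \<le> real n" by (metis of_nat_mult of_nat_le_iff div_times_less_eq_dividend)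
      qed (simp add: nonneg)
      also have "a (n mod N) \<le> B" using N by (intro aB) simp
      finally have "a n \<le> real n * (a N / real N) + B" by simp
      hence "a n / real n \<le> a N / real N + B / real n" using n0 by (simp add: field_simps)
      moreover have "B / real n < \<epsilon> / 2"
      proof -
        have "2 * B / \<epsilon> < real n" using M n by linarith
        thus ?thesis using \<epsilon> n0 by (simp add: field_simps)
      qed
      ultimately have "a n / real n < L + \<epsilon>" using N by linarith
      moreover have "L \<le> a n / real n" using n by (intro le) simp
      ultimately show "norm (a n / real n - L) < \<epsilon>" by simp
    qed
  qed
  thus thesis using \<open>0 \<le> L\<close> le that by blast
qed

lemma le_if_eventually_linear_le:
  fixes \<alpha> \<beta> \<gamma> :: real
  assumes "\<And>s :: nat. s \<ge> s0 \<Longrightarrow> \<alpha> * real s \<le> \<beta> * real s + \<gamma>"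
  shows "\<alpha> \<le> \<beta>"
proof (rule ccontr)
  assume "\<not> \<alpha> \<le> \<beta>"
  hence pos: "\<alpha> - \<beta> > 0" by simp
  obtain n :: nat where n: "\<gamma> / (\<alpha> - \<beta>) < real n" using reals_Archimedean2 by blast
  define s where "s = max s0 n"
  have "\<gamma> / (\<alpha> - \<beta>) < real s" using n by (simp add: s_def)
  hence "\<gamma> < (\<alpha> - \<beta>) * real s" using pos by (simp add: field_simps)
  moreover have "\<alpha> * real s \<le> \<beta> * real s + \<gamma>" using assms[of s] by (simp add: s_def)
  ultimately show False by (simp add: algebra_simps)
qed

text \<open>
  The exponent is the infimum of the sequence in its definition, so a rank bound for a single power bounds it. The summand 1 accounts
  for rounding \<open>log 2 r\<close> up to an integer.
\<close>

lemma exponent_le_if_rank_le: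
  fixes V :: "'v set" and E :: "'v set set"
  assumes V: "finite V" "V \<noteq> {}" and E: "finite E" "\<And>e. e \<in> E \<Longrightarrow> e \<subseteq> V \<and> e \<noteq> {}"
    and finite_rank: "\<And>n. \<exists>r. rank_le V (graph_power_function E n) r"
  shows "0 \<le> exponent (graph_tensor 2 V E)"
    and "rank_le V (graph_power_function E n) r \<Longrightarrow> r > 0 \<Longrightarrow>
           exponent (graph_tensor 2 V E) * real n \<le> log 2 (real r) + 1"
proof -
  define F where "F = (graph_power_function E :: nat \<Rightarrow> ('v \<Rightarrow> nat \<Rightarrow> 'v set \<Rightarrow> nat) \<Rightarrow> complex)"
  define c where "c = (\<lambda>n. LEAST m. rank_le V (F n) (2 ^ m))"
  have c: "rank_le V (F n) (2 ^ c n)" for n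
  proof -
    obtain r where "rank_le V (F n) r" using finite_rank by (auto simp: F_def)
    hence "rank_le V (F n) (2 ^ r)" by (rule rank_le_mono) simp
    thus ?thesis unfolding c_def by (rule LeastI)
  qed
  have c_le: "c n \<le> m" if "rank_le V (F n) (2 ^ m)" for n m
    unfolding c_def using that by (rule Least_le)
  have "c (m + n) \<le> c m + c n" for m n
  proof (rule c_le)
    have "F (m + n) = (\<lambda>x. F m x * F n (\<lambda>v. (\<lambda>j. x v (m + j))))"
    proof (rule ext)
      fix x :: "'v \<Rightarrow> nat \<Rightarrow> 'v set \<Rightarrow> nat"
      have "(\<forall>j<m + n. Q j) \<longleftrightarrow> (\<forall>j<m. Q j) \<and> (\<forall>j<n. Q (m + j))" for Q
        by (metis add_diff_inverse_nat nat_add_left_cancel_less trans_less_add1)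
      hence "(\<forall>e\<in>E. \<forall>j<m + n. \<exists>i\<in>{1..2}. \<forall>v\<in>e. x v j e = i) \<longleftrightarrow>
         (\<forall>e\<in>E. \<forall>j<m. \<exists>i\<in>{1..2}. \<forall>v\<in>e. x v j e = i) \<and> (\<forall>e\<in>E. \<forall>j<n. \<exists>i\<in>{1..2}. \<forall>v\<in>e. x v (m + j) e = i)"
        by (simp only: ball_conj_distrib)
      thus "F (m + n) x = F m x * F n (\<lambda>v. (\<lambda>j. x v (m + j)))"
        by (simp only: F_def graph_power_function_def of_bool_conj)
    qed
    moreover have "rank_le V (\<lambda>x. F m x * F n (\<lambda>v. (\<lambda>j. x v (m + j)))) (2 ^ c m * 2 ^ c n)"
      by (intro rank_le_mult c rank_le_pullback[OF c, where g = "\<lambda>_ y j. y (m + j)"])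
    ultimately show "rank_le V (F (m + n)) (2 ^ (c m + c n))" by (simp add: power_add)
  qed
  hence sub: "real (c (m + n)) \<le> real (c m) + real (c n)" for m n
    by (simp flip: of_nat_add)
  obtain L where L: "(\<lambda>n. real (c n) / real n) \<longlonglongrightarrow> L" "0 \<le> L" "\<And>n. n > 0 \<Longrightarrow> L \<le> real (c n) / real n"
    using fekete[of "\<lambda>n. real (c n)"] sub by (metis of_nat_0_le_iff)
  have legs: "legs (graph_tensor 2 V E) = V" by (simp add: graph_tensor_def)
  have "exponent (graph_tensor 2 V E) = lim (\<lambda>n. real (c n) / real n)"
  proof -
    have "restricts_to (tensor_power (unit_tensor V) m) (tensor_power (graph_tensor 2 V E) n) \<longleftrightarrow>
        rank_le V (F n) (2 ^ m)" for m n
      unfolding F_def by (rule restricts_to_graph_power_iff_rank_le[OF V E])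
    thus ?thesis by (simp only: exponent_def legs c_def)
  qed
  also have "\<dots> = L" by (rule limI[OF L(1)])
  finally have ex: "exponent (graph_tensor 2 V E) = L" .
  thus "0 \<le> exponent (graph_tensor 2 V E)" using L(2) by simp
  assume r: "rank_le V (graph_power_function E n) r" "r > 0"
  define m where "m = nat \<lceil>log 2 (real r)\<rceil>"
  have m: "log 2 (real r) \<le> real m" "real m \<le> log 2 (real r) + 1"
    using r(2) by (auto simp: m_def)
  have "real r = 2 powr log 2 (real r)" using r(2) by simp
  also have "\<dots> \<le> 2 powr real m" by (intro powr_mono m) simp
  finally have "real r \<le> real (2 ^ m)" by (simp add: powr_realpow)
  hence "r \<le> 2 ^ m" unfolding of_nat_le_iff .
  hence "c n \<le> m" using r(1) by (intro c_le) (auto simp: F_def intro: rank_le_mono)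
  moreover have "L * real n \<le> real (c n)" using L(3)[of n] by (cases "n = 0") (auto simp: field_simps)
  ultimately show "exponent (graph_tensor 2 V E) * real n \<le> log 2 (real r) + 1"
    unfolding ex using m(2) by linarith
qed

section \<open>The minimum over the local dimension\<close>

lemma ln_less_if_power_less:
  fixes x y :: real
  assumes "x ^ a < y ^ b" "0 < x" "0 < y"
  shows "real a * ln x < real b * ln y"
proof -
  have "ln (x ^ a) < ln (y ^ b)" using assms by (subst ln_less_cancel_iff) auto
  thus ?thesis using assms by (simp add: ln_realpow)
qed

lemma ln_less_if_scaled_power_less:
  fixes r x y :: real
  assumes "0 < r" "0 < x" "0 < y"
  shows "r * x ^ a < y ^ b \<Longrightarrow> ln r + real a * ln x < real b * ln y"
    and "y ^ b < r * x ^ a \<Longrightarrow> real b * ln y < ln r + real a * ln x"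
proof -
  have eq: "ln r + real a * ln x = ln (r * x ^ a)" "real b * ln y = ln (y ^ b)"
    using assms by (simp_all add: ln_mult_pos ln_realpow)
  show "r * x ^ a < y ^ b \<Longrightarrow> ln r + real a * ln x < real b * ln y"
    and "y ^ b < r * x ^ a \<Longrightarrow> real b * ln y < ln r + real a * ln x"
    unfolding eq using assms by (subst ln_less_cancel_iff; simp)+
qed

text \<open>
  With \<open>A = (9 / 2) ^ 22 / 7 ^ 17\<close> and \<open>B = 7 ^ 160 / (9 / 2) ^ 207\<close>, which come from two convergents of
  \<open>log 7 (9 / 2)\<close> and are both slightly larger than 1, the two bounds say
  \<open>B ^ 11 < A\<^sup>2\<close> and \<open>A < B ^ 6\<close>. Rounding \<open>A\<close> and \<open>B\<close> keeps the numbers small.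
\<close>

lemma log_7_nine_halves_approx: "\<bar>log 7 (9 / 2) - 0.772943 :: real\<bar> < 5 / 10 ^ 7"
proof -
  define L where "L = ln (9 / 2 :: real)"
  define S where "S = ln (7 :: real)"
  have S: "S > 0" by (simp add: S_def)
  have "ln (100927 / 100000) + real 17 * S < real 22 * L"
    unfolding L_def S_def by (rule ln_less_if_scaled_power_less) (simp_all add: power_divide)
  moreover have "real 22 * L < ln (100928 / 100000) + real 17 * S"
    unfolding L_def S_def by (rule ln_less_if_scaled_power_less) (simp_all add: power_divide)
  moreover have "ln (1001603 / 1000000) + real 207 * L < real 160 * S"
    unfolding L_def S_def by (rule ln_less_if_scaled_power_less) (simp_all add: power_divide)
  moreover have "real 160 * S < ln (1001605 / 1000000) + real 207 * L"
    unfolding L_def S_def by (rule ln_less_if_scaled_power_less) (simp_all add: power_divide)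
  moreover have "real 11 * ln (1001605 / 1000000) < real 2 * ln (100927 / 100000)"
    by (rule ln_less_if_power_less) (simp_all add: power_divide)
  moreover have "real 1 * ln (100928 / 100000) < real 6 * ln (1001603 / 1000000)"
    by (rule ln_less_if_power_less) (simp_all add: power_divide)
  ultimately have "1794 * S < 2321 * L" "1264 * L < 977 * S"
    unfolding of_nat_numeral of_nat_1 by argo+
  hence "1794 / 2321 < L / S" "L / S < 977 / 1264" using S by (simp_all add: field_simps)
  moreover define r where "r = L / S"
  ultimately have "\<bar>r - 0.772943\<bar> < 5 / 10 ^ 7" by (simp add: abs_if)
  thus ?thesis by (simp add: r_def L_def S_def log_def)
qed

text \<open>
  For \<open>c = log 7 (9 / 2)\<close>, the function \<open>ln ((x + 2) / 2) - c * ln x\<close> decreases up to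
  \<open>2 * c / (1 - c)\<close> and increases afterwards. As this point lies between 6 and 7, it suffices that the function is
  nonnegative at 6 and vanishes at 7.
\<close>

lemma log_ratio_minimal_at_7:
  fixes q :: nat
  assumes "q \<ge> 2"
  shows "log 7 (9 / 2) \<le> log (real q) ((real q + 2) / 2)"
proof -
  define c :: real where "c = log 7 (9 / 2)"
  define f where "f = (\<lambda>x::real. ln ((x + 2) / 2) - c * ln x)"
  have c7: "c * ln 7 = ln (9 / 2)" by (simp add: c_def log_def)
  have pos: "0 < c" by (simp add: c_def)
  have c_lt: "c < 7 / 9" 
    using ln_less_if_power_less[of "9 / 2" 9 7 7] by (simp add: c_def log_def field_simps power_divide)
  have c_gt: "3 / 4 < c"
    using ln_less_if_power_less[of 7 3 "9 / 2" 4] by (simp add: c_def log_def field_simps power_divide)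
  have deriv: "(f has_real_derivative (1 / (x + 2) - c / x)) (at x)" if "x > 0" for x
    unfolding f_def using that by (auto intro!: derivative_eq_intros simp: field_simps)
  have f7: "f 7 = 0" using c7 by (simp add: f_def)
  have "0 \<le> f (real q)"
  proof (cases "q \<ge> 7")
    case True
    have "f 7 \<le> f (real q)"
    proof (rule DERIV_nonneg_imp_nondecreasing[where f = f])
      show "(7::real) \<le> real q" using True by simp
      fix x :: real assume "7 \<le> x" "x \<le> real q"
      have "c * (x + 2) \<le> 7 / 9 * (x + 2)" using c_lt \<open>7 \<le> x\<close> by (intro mult_right_mono) auto
      also have "7 / 9 * (x + 2) \<le> x" using \<open>7 \<le> x\<close> by (simp add: field_simps)
      finally have "c * (x + 2) \<le> x" .
      hence "0 \<le> 1 / (x + 2) - c / x" using \<open>7 \<le> x\<close> by (simp add: field_simps)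
      thus "\<exists>y. DERIV f x :> y \<and> 0 \<le> y" using deriv[of x] \<open>7 \<le> x\<close> by force
    qed
    thus ?thesis by (simp add: f7)
  next
    case False
    have "c * ln 6 \<le> ln 4"
    proof -
      \<comment> \<open>The fraction \<open>41 / 53\<close> separates \<open>log 7 (9 / 2)\<close> from \<open>log 6 4\<close>.\<close>
      have "c < 41 / 53"
        using ln_less_if_power_less[of "9 / 2" 53 7 41] by (simp add: c_def log_def field_simps power_divide)
      hence "c * ln 6 \<le> 41 / 53 * ln 6" by (intro mult_right_mono) auto
      moreover have "real 41 * ln 6 < real 53 * ln 4" by (rule ln_less_if_power_less) simp_all
      ultimately show ?thesis by linarith
    qed
    hence f6: "0 \<le> f 6" by (simp add: f_def)
    have "f 6 \<le> f (real q)"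
    proof (rule DERIV_nonpos_imp_nonincreasing[where f = f])
      show "real q \<le> 6" using False by simp
      fix x :: real assume x: "real q \<le> x" "x \<le> 6"
      have x0: "x > 0" using x assms by linarith
      have "3 / 4 * (x + 2) \<le> c * (x + 2)" using c_gt x0 by (intro mult_right_mono) auto
      moreover have "x \<le> 3 / 4 * (x + 2)" using x by (simp add: field_simps)
      ultimately have "x \<le> c * (x + 2)" by linarith
      hence "1 / (x + 2) \<le> c / x" using x0 by (simp add: field_simps)
      thus "\<exists>y. DERIV f x :> y \<and> y \<le> 0" using deriv[OF x0] by force
    qed
    thus ?thesis using f6 by linarith
  qed
  moreover have "ln (real q) > 0" using assms by simp
  ultimately show ?thesis by (simp add: f_def c_def [symmetric] log_def [of "real q"] field_simps)
qed

section \<open>The exponent of the complete graph tensor\<close>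

text \<open>
  The blocks have \<open>u\<^sup>2\<close> labels per edge and come from the power \<open>6 * u\<^sup>2\<close>. Dividing the rank of that power by
  the number of blocks gives \<open>t\<close>. The bounds do not depend on \<open>S\<close>, so that they can be multiplied over all
  four-subsets.
\<close>

lemma rank_le_four_vertex_powers:
  fixes q :: nat
  assumes q: "q \<ge> 2"
  defines "X \<equiv> (real q + 2) / 2"
  shows "\<exists>D\<ge>1. \<forall>u\<ge>2. \<exists>t :: nat. t > 0 \<and> real t \<le> X ^ (6 * u\<^sup>2) * D ^ u \<and>
    (\<forall>S :: 'v set. card S = 4 \<longrightarrow> (\<forall>s. rank_le S (edge_tensor (complete_edges S) (\<lambda>_. {..<s} \<times> {..<u\<^sup>2}) q)
       (6 ^ (6 * u\<^sup>2) * t ^ s)))"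
proof -
  define C :: real where "C = 130 * 1024 * 64 * 2916"
  have "\<exists>t :: nat. t > 0 \<and> real t \<le> X ^ (6 * u\<^sup>2) * (200 * C) ^ u \<and>
    (\<forall>S :: 'v set. card S = 4 \<longrightarrow> (\<forall>s. rank_le S (edge_tensor (complete_edges S) (\<lambda>_. {..<s} \<times> {..<u\<^sup>2}) q)
       (6 ^ (6 * u\<^sup>2) * t ^ s)))" if u: "u \<ge> 2" for u :: nat
  proof -
    define N where "N = 6 * u\<^sup>2"
    define R where "R = (2 * 4 * N + 1) * (q + 2) ^ N"
    define Y where "Y = real R * C ^ u / 64 ^ u\<^sup>2"
    define t where "t = nat \<lceil>Y\<rceil>"
    have "R > 0" by (simp add: R_def)
    hence Y: "Y > 0" by (simp add: Y_def C_def)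
    hence t: "t > 0" "Y \<le> real t" "real t \<le> Y + 1" by (auto simp: t_def)
    have "real t \<le> X ^ N * (200 * C) ^ u"
    proof -
      have X: "1 \<le> X" using q by (simp add: X_def)
      hence X1: "1 \<le> X ^ N" by (rule one_le_power)
      have C1: "1 \<le> C ^ u" by (intro one_le_power) (simp add: C_def)
      have "(64 :: real) ^ u\<^sup>2 = 2 ^ N" by (simp add: N_def power_mult)
      moreover have "real R = real (8 * N + 1) * (real q + 2) ^ N" by (simp add: R_def algebra_simps)
      ultimately have "Y = real (8 * N + 1) * X ^ N * C ^ u"
        unfolding Y_def X_def power_divide by simp
      hence "real t \<le> real (8 * N + 1) * (X ^ N * C ^ u) + 1" using t(3) by simp
      also have "1 \<le> X ^ N * C ^ u" using mult_mono[OF X1 C1] X1 by simp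
      also have "real (8 * N + 1) * (X ^ N * C ^ u) + X ^ N * C ^ u = (48 * (real u)\<^sup>2 + 2) * (X ^ N * C ^ u)"
        by (simp add: N_def algebra_simps)
      also have "\<dots> \<le> 200 ^ u * (X ^ N * C ^ u)"
      proof (rule mult_right_mono)
        have le2: "real u \<le> 2 ^ u" using of_nat_less_two_power[of u, where ?'a = real] by simp
        have "(real u)\<^sup>2 \<le> (2 ^ u)\<^sup>2" using le2 by (intro power_mono) auto
        also have "(2 ^ u)\<^sup>2 = (4 :: real) ^ u" by (simp add: power_swap[of 2 u 2])
        finally have "48 * (real u)\<^sup>2 + 2 \<le> 50 * 4 ^ u" using one_le_power[of "4 :: real" u] by linarith
        also have "\<dots> \<le> 50 ^ u * 4 ^ u"
          using u power_increasing[of 1 u "50 :: real"] by (intro mult_right_mono) auto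
        also have "\<dots> = 200 ^ u" by (simp flip: power_mult_distrib)
        finally show "48 * (real u)\<^sup>2 + 2 \<le> 200 ^ u" .
      qed (use X1 C1 in auto)
      finally show ?thesis by (simp add: power_mult_distrib mult_ac)
    qed
    moreover have "rank_le S (edge_tensor (complete_edges S) (\<lambda>_. {..<s} \<times> {..<u\<^sup>2}) q) (6 ^ N * t ^ s)"
      if S: "card S = 4" for S :: "'v set" and s
    proof -
      have S': "finite S" "S \<noteq> {}" using S by (auto intro: card_ge_0_finite)
      obtain \<Lambda> where \<Lambda>: "\<Lambda> \<subseteq> balanced_words N (u\<^sup>2) (complete_edges S)" "leg_free S N \<Lambda>"
        "64 ^ u\<^sup>2 \<le> C ^ u * real (card \<Lambda>)"
        using large_free_family[OF S u] unfolding N_def C_def by blast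
      have sub: "\<Lambda> \<subseteq> {..<N} \<rightarrow>\<^sub>E complete_edges S" using \<Lambda>(1) by (auto simp: balanced_words_def)
      have fin: "finite ({..<N} \<rightarrow>\<^sub>E complete_edges S)"
        using S' by (intro finite_PiE finite_complete_edges) auto
      have "card \<Lambda> \<le> card ({..<N} \<rightarrow>\<^sub>E complete_edges S)" by (rule card_mono[OF fin sub])
      also have "\<dots> = 6 ^ N" using S S' by (simp add: card_PiE card_complete_edges choose_two)
      finally have card: "card \<Lambda> \<le> 6 ^ N" .
      have "real (card \<Lambda>) \<noteq> 0" 
      proof
        assume "real (card \<Lambda>) = 0"
        hence "(64 :: real) ^ u\<^sup>2 \<le> 0" using \<Lambda>(3) by simp
        moreover have "0 < (64 :: real) ^ u\<^sup>2" by simp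
        ultimately show False by linarith
      qed
      hence \<Lambda>': "finite \<Lambda>" "\<Lambda> \<noteq> {}" using finite_subset[OF sub fin] by auto
      have "real R * 64 ^ u\<^sup>2 \<le> real R * (C ^ u * real (card \<Lambda>))" by (intro mult_left_mono \<Lambda>(3)) simp
      hence "real R \<le> Y * real (card \<Lambda>)" by (simp add: Y_def field_simps)
      also have "\<dots> \<le> real t * real (card \<Lambda>)" by (intro mult_right_mono t(2)) simp
      finally have "real R \<le> real (card \<Lambda> * t)" by (simp add: mult.commute)
      hence R: "R \<le> card \<Lambda> * t" unfolding of_nat_le_iff .
      have "rank_le S (edge_tensor (complete_edges S) (\<lambda>_. {..<s} \<times> {..<u\<^sup>2}) q) (card \<Lambda> * t ^ s)"
        using rank_le_direct_sum_of_blocks[OF S' \<Lambda>(1,2), of q] R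
        by (intro rank_le_edge_tensor_powers[OF S' \<Lambda>']) (simp_all add: R_def S)
      thus ?thesis by (rule rank_le_mono) (simp add: card)
    qed
    ultimately show ?thesis using t(1) unfolding N_def by blast
  qed
  moreover have "200 * C \<ge> 1" by (simp add: C_def)
  ultimately show ?thesis by blast
qed

text \<open>
  A power with \<open>s\<close> batches of \<open>u\<^sup>2\<close> labels for each four-subset bounds the exponent. Letting \<open>s\<close> tend to
  infinity removes the number of blocks from the bound, and letting \<open>u\<close> tend to infinity removes the
  subexponential losses. The factor 6 is the number of edges of a four-subset, and counting the pairs in four-subsets
  in two ways turns the result into a bound per edge.
\<close>

theorem exponent_per_edge_complete_graph_le:
  fixes V :: "'v set" and q :: nat
  assumes V: "card V \<ge> 4" and q: "q \<ge> 2"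
  shows "exponent_per_edge V (complete_edges V) \<le> log (real q) ((real q + 2) / 2)"
proof -
  define k where "k = card V"
  define b where "b = k choose 4"
  define c where "c = (k - 2) choose 2"
  define E where "E = complete_edges V"
  define \<omega> where "\<omega> = exponent (graph_tensor 2 V E)"
  define X where "X = (real q + 2) / 2"
  have fin: "finite V" "V \<noteq> {}" using V by (auto intro: card_ge_0_finite)
  have E: "finite E" "\<And>e. e \<in> E \<Longrightarrow> e \<subseteq> V \<and> e \<noteq> {}"
    using finite_complete_edges[OF fin(1)] by (auto simp: E_def complete_edges_def)
  have c: "c > 0" using V by (simp add: c_def k_def zero_less_binomial_iff)
  have X: "X > 0" by (simp add: X_def)
  obtain D where D: "D \<ge> 1" and ex: "\<forall>u\<ge>2. \<exists>t :: nat. t > 0 \<and> real t \<le> X ^ (6 * u\<^sup>2) * D ^ u \<and>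
    (\<forall>S :: 'v set. card S = 4 \<longrightarrow> (\<forall>s. rank_le S (edge_tensor (complete_edges S) (\<lambda>_. {..<s} \<times> {..<u\<^sup>2}) q)
       (6 ^ (6 * u\<^sup>2) * t ^ s)))"
    using rank_le_four_vertex_powers[OF q, where ?'v = 'v] unfolding X_def by blast
  have rank: "rank_le V (graph_power_function E n) ((6 ^ (6 * u\<^sup>2) * t ^ s) ^ b)"
    if t: "\<forall>S :: 'v set. card S = 4 \<longrightarrow> (\<forall>s. rank_le S (edge_tensor (complete_edges S) (\<lambda>_. {..<s} \<times> {..<u\<^sup>2}) q)
       (6 ^ (6 * u\<^sup>2) * t ^ s))" and n: "2 ^ n \<le> q ^ (c * (s * u\<^sup>2))" for u t s n
  proof (rule rank_le_graph_power_function)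
    show "rank_le V (edge_tensor E (\<lambda>e. {S. S \<subseteq> V \<and> card S = 4 \<and> e \<subseteq> S} \<times> ({..<s} \<times> {..<u\<^sup>2})) q)
       ((6 ^ (6 * u\<^sup>2) * t ^ s) ^ b)"
      unfolding E_def b_def k_def using t by (intro rank_le_complete_graph_from_four_subsets fin) auto
    show "e \<noteq> {} \<and> finite ({S. S \<subseteq> V \<and> card S = 4 \<and> e \<subseteq> S} \<times> ({..<s} \<times> {..<u\<^sup>2})) \<and>
       2 ^ n \<le> q ^ card ({S. S \<subseteq> V \<and> card S = 4 \<and> e \<subseteq> S} \<times> ({..<s} \<times> {..<u\<^sup>2}))" if e: "e \<in> E" for e
      using n E(2)[OF e] fin card_four_subsets_containing[OF fin(1) e[unfolded E_def]]
      by (simp add: card_cartesian_product c_def k_def)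
  qed
  have finite_rank: "\<exists>r. rank_le V (graph_power_function E n) r" for n
  proof -
    obtain t where t: "\<forall>S :: 'v set. card S = 4 \<longrightarrow> (\<forall>s. rank_le S (edge_tensor (complete_edges S) (\<lambda>_. {..<s} \<times> {..<(2 :: nat)\<^sup>2}) q)
       (6 ^ (6 * 2\<^sup>2) * t ^ s))" using ex by blast
    have "2 ^ n \<le> q ^ n" using q by (intro power_mono) auto
    also have "\<dots> \<le> q ^ (c * (n * 2\<^sup>2))" using q c by (intro power_increasing) (auto simp: Suc_le_eq)
    finally show ?thesis using rank[OF t] by blast
  qed
  note upper = exponent_le_if_rank_le[OF fin E finite_rank]
  have \<omega>0: "0 \<le> \<omega>" using upper(1) by (simp add: \<omega>_def)
  define \<kappa> where "\<kappa> = log 2 (real q)"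
  define \<xi> where "\<xi> = log 2 X"
  define \<delta> where "\<delta> = log 2 D"
  have \<kappa>: "\<kappa> > 0" using q by (simp add: \<kappa>_def)
  have bound: "\<omega> * (real c * (real s * (real u)\<^sup>2) * \<kappa>) \<le>
      real b * (6 * (real u)\<^sup>2 * log 2 6 + real s * (6 * (real u)\<^sup>2 * \<xi> + real u * \<delta>)) + 1 + \<omega>"
    if u: "u \<ge> 2" for u s
  proof -
    obtain t where t: "t > 0" "real t \<le> X ^ (6 * u\<^sup>2) * D ^ u"
      "\<forall>S :: 'v set. card S = 4 \<longrightarrow> (\<forall>s. rank_le S (edge_tensor (complete_edges S) (\<lambda>_. {..<s} \<times> {..<u\<^sup>2}) q)
       (6 ^ (6 * u\<^sup>2) * t ^ s))" using ex u by blast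
    define w where "w = c * (s * u\<^sup>2)"
    define n where "n = nat \<lfloor>real w * \<kappa>\<rfloor>"
    have n: "real n \<le> real w * \<kappa>" "real w * \<kappa> - 1 \<le> real n" using \<kappa> by (auto simp: n_def)
    have "real (2 ^ n) = 2 powr real n" by (simp add: powr_realpow)
    also have "\<dots> \<le> 2 powr (\<kappa> * real w)" using n(1) by (intro powr_mono) (auto simp: mult.commute)
    also have "\<dots> = real (q ^ w)" using q by (simp add: \<kappa>_def powr_powr [symmetric] powr_realpow)
    finally have "2 ^ n \<le> q ^ w" unfolding of_nat_le_iff .
    from rank[OF t(3) this[unfolded w_def]]
    have "\<omega> * real n \<le> log 2 (real ((6 ^ (6 * u\<^sup>2) * t ^ s) ^ b)) + 1"
      unfolding \<omega>_def using t(1) by (intro upper(2)) auto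
    also have "log 2 (real ((6 ^ (6 * u\<^sup>2) * t ^ s) ^ b)) = real b * (6 * (real u)\<^sup>2 * log 2 6 + real s * log 2 (real t))"
      using t(1) by (simp add: log_nat_power log_mult_pos)
    also have "log 2 (real t) \<le> log 2 (X ^ (6 * u\<^sup>2) * D ^ u)" using t by simp
    also have "\<dots> = 6 * (real u)\<^sup>2 * \<xi> + real u * \<delta>"
      using X D by (simp add: log_mult_pos log_nat_power \<xi>_def \<delta>_def)
    finally have "\<omega> * real n \<le> real b * (6 * (real u)\<^sup>2 * log 2 6 + real s * (6 * (real u)\<^sup>2 * \<xi> + real u * \<delta>)) + 1"
      by (simp add: mult_left_mono)
    moreover have "\<omega> * (real w * \<kappa> - 1) \<le> \<omega> * real n" by (intro mult_left_mono n \<omega>0)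
    ultimately show ?thesis by (simp add: w_def algebra_simps)
  qed
  have step: "\<omega> * real c * (real u)\<^sup>2 * \<kappa> \<le> real b * (6 * (real u)\<^sup>2 * \<xi> + real u * \<delta>)" if u: "u \<ge> 2" for u
  proof (rule le_if_eventually_linear_le[of 0 _ _ "real b * (6 * (real u)\<^sup>2 * log 2 6) + 1 + \<omega>"])
    show "\<omega> * real c * (real u)\<^sup>2 * \<kappa> * real s \<le> real b * (6 * (real u)\<^sup>2 * \<xi> + real u * \<delta>) * real s +
        (real b * (6 * (real u)\<^sup>2 * log 2 6) + 1 + \<omega>)" for s
      using bound[OF u, of s] by (simp add: algebra_simps)
  qed
  have "\<omega> * real c * \<kappa> \<le> real b * 6 * \<xi>"
  proof (rule le_if_eventually_linear_le[of 2 _ _ "real b * \<delta>"])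
    fix u :: nat assume u: "2 \<le> u"
    have "real u * (\<omega> * real c * \<kappa> * real u) \<le> real u * (real b * 6 * \<xi> * real u + real b * \<delta>)"
      using step[OF u] by (simp add: power2_eq_square algebra_simps)
    thus "\<omega> * real c * \<kappa> * real u \<le> real b * 6 * \<xi> * real u + real b * \<delta>"
      using u by (subst (asm) mult_le_cancel_left_pos) auto
  qed
  moreover have "real b * 6 = real (card E) * real c"
  proof -
    have "(k choose 4) * (4 choose 2) = (k choose 2) * ((k - 2) choose (4 - 2))"
      using V by (intro choose_mult) (simp_all add: k_def)
    moreover have "(4 choose 2 :: nat) = 6" by (simp add: choose_two)
    ultimately have "b * 6 = card E * c"
      using card_complete_edges[OF fin(1)] by (simp add: b_def c_def E_def k_def)
    thus ?thesis by (simp flip: of_nat_mult)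
  qed
  ultimately have "real c * (\<omega> * \<kappa>) \<le> real c * (real (card E) * \<xi>)" by (simp add: mult_ac)
  hence "\<omega> * \<kappa> \<le> real (card E) * \<xi>" using c by (subst (asm) mult_le_cancel_left_pos) auto
  moreover have "real (card E) > 0"
    using card_complete_edges[OF fin(1)] V by (simp add: E_def zero_less_binomial_iff)
  ultimately have "\<omega> / real (card E) \<le> \<xi> / \<kappa>" using \<kappa> by (simp add: field_simps)
  also have "\<xi> / \<kappa> = log (real q) X"
    using q X by (simp add: \<xi>_def \<kappa>_def log_def)
  finally show ?thesis by (simp add: exponent_per_edge_def \<omega>_def E_def X_def)
qed

theorem corollary1p2p6:
  fixes k :: nat and M :: "real set"
  assumes "k \<ge> 4"
  defines "M \<equiv> {log (real q) ((real q + 2) / 2) | q :: nat. q \<ge> 2}"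
  shows "\<exists>m. m \<in> M \<and> (\<forall>x\<in>M. m \<le> x) \<and>
             exponent_per_edge {1..k} (complete_edges {1..k}) \<le> m \<and>
             m = log 7 (9 / 2) \<and>
             \<bar>m - 0.772943\<bar> < 5 / 10 ^ 7"
proof (intro exI conjI)
  show "log 7 (9 / 2) \<in> M"
    unfolding M_def by (rule CollectI, rule exI[of _ 7]) simp
  show "\<forall>x\<in>M. log 7 (9 / 2) \<le> x"
    unfolding M_def using log_ratio_minimal_at_7 by blast
  show "exponent_per_edge {1..k} (complete_edges {1..k}) \<le> log 7 (9 / 2)"
    using exponent_per_edge_complete_graph_le[of "{1..k}" 7] assms(1) by simp
  show "\<bar>log 7 (9 / 2) - 0.772943 :: real\<bar> < 5 / 10 ^ 7"
    by (rule log_7_nine_halves_approx)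
qed (rule refl)

end
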